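(* Let $m,n,k,s\in\mathbb N$ (nonnegative integers), $g(x)=\sum_{i=k}^{m}a_ix^i$, $f(x)=\sum_{i=s}^{n}b_ix^i$ be real polynomials with $a_ka_mb_sb_n\neq0$, and consider the polynomial Liénard system $\dot x=y,\ \dot y=-g(x)-f(x)y$. Assume that $g$ is an odd function. Then $P_\infty$ is a center at infinity of the system if and only if $f$ is odd and the following condition holds: $m$ and $n$ are odd, and either $m>2n+1$ and $a_m>0$, or $m=2n+1$ and $4(n+1)a_mb_n^{-2}>1$.
   Context: The Poincaré disc is the closed unit disc obtained by central projection of the phase plane onto a hemisphere followed by vertical projection; the interior is identified with the plane and the boundary circle with the points at infinity. $P_\infty$ is called a center at infinity of a planar differential system if there is a neighborhood $U$ of the unit circle in the Poincaré disc that is filled with closed orbits (that is, every orbit in $U$ through a finite point is a closed orbit). *)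

theory Defs
  imports "HOL-Analysis.Analysis"
begin

text \<open>
  The phase plane is identified with the plane of height 1 in 3-space, tangent to the unit sphere
  at its north pole; the projection is taken from the centre of the sphere.
\<close>

definition central_projection :: "real \<times> real \<Rightarrow> (real \<times> real) \<times> real" where
  "central_projection p = (1 / norm (p, 1::real)) *\<^sub>R (p, 1)"

text \<open>
  The image of this map is the open unit disc; the unit circle carries the points at infinity.
\<close>

definition poincare_projection :: "real \<times> real \<Rightarrow> real \<times> real" where
  "poincare_projection p = fst (central_projection p)"

lemma poincare_projection_eq:
  "poincare_projection (x, y) = (x / sqrt (1 + x\<^sup>2 + y\<^sup>2), y / sqrt (1 + x\<^sup>2 + y\<^sup>2))"
  by (simp add: poincare_projection_def central_projection_def norm_prod_def add.commute add.left_commute)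

abbreviation poincare_disc :: "(real \<times> real) set" where
  "poincare_disc \<equiv> cball 0 1"

abbreviation circle_at_infinity :: "(real \<times> real) set" where
  "circle_at_infinity \<equiv> sphere 0 1"

text \<open>Equilibria do not count as closed orbits.\<close>

definition closed_orbit :: "(real \<times> real \<Rightarrow> real \<times> real) \<Rightarrow> (real \<times> real) set \<Rightarrow> bool" where
  "closed_orbit X C \<longleftrightarrow>
     (\<exists>\<gamma> T. (\<forall>t. (\<gamma> has_vector_derivative X (\<gamma> t)) (at t)) \<and>
            0 < T \<and> (\<forall>t. \<gamma> (t + T) = \<gamma> t) \<and> \<not> \<gamma> constant_on UNIV \<and> C = range \<gamma>)"

text \<open>
  The finite part of the neighbourhood \<open>U\<close> is a union of (projected) closed orbits.
  Neighbourhoods need not be open.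
\<close>

definition center_at_infinity :: "(real \<times> real \<Rightarrow> real \<times> real) \<Rightarrow> bool" where
  "center_at_infinity X \<longleftrightarrow>
     (\<exists>U V. openin (top_of_set poincare_disc) V \<and> circle_at_infinity \<subseteq> V \<and> V \<subseteq> U \<and> U \<subseteq> poincare_disc \<and>
        (\<forall>p. poincare_projection p \<in> U \<longrightarrow>
           (\<exists>C. closed_orbit X C \<and> p \<in> C \<and> poincare_projection ` C \<subseteq> U)))"

definition lienard :: "(real \<Rightarrow> real) \<Rightarrow> (real \<Rightarrow> real) \<Rightarrow> real \<times> real \<Rightarrow> real \<times> real" where
  "lienard g f = (\<lambda>(x, y). (y, - g x - f x * y))"

definition odd_fun :: "(real \<Rightarrow> real) \<Rightarrow> bool" where
  "odd_fun h \<longleftrightarrow> (\<forall>x. h (- x) = - h x)"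

end

theory Submission
  imports Defs
begin

text \<open>
  A center at infinity means that every orbit starting far enough from the origin is closed
  (\<open>center_at_infinity_iff\<close>). Write \<open>N = (m + 1) / 2\<close>; \<open>m\<close> is odd because \<open>g\<close> is.

  \<^bold>\<open>Rotation.\<close> With \<open>u = x + x ^ N\<close> and \<open>r\<^sup>2 = u\<^sup>2 + y\<^sup>2\<close>, the polar angle of \<open>(u, y)\<close> along an orbit
  in the half-plane \<open>x \<ge> 0\<close> has derivative \<open>- (u' y\<^sup>2 + f u y + g u) / r\<^sup>2\<close>. If \<open>a m > 0\<close> and either
  \<open>m > 2 n + 1\<close> or \<open>m = 2 n + 1\<close> and \<open>(b n)\<^sup>2 < 4 (n + 1) (a m)\<close>, the quadratic form in the numerator is
  positive definite far out, and \<open>\<bar>d (ln r) / d \<theta>\<bar>\<close> is bounded (\<open>lienard_right_rotation\<close>). So a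
  far orbit crosses the right half-plane in a half turn that ends on the negative \<open>y\<close>-axis, and \<open>r\<close>
  changes by a bounded factor only (\<open>forward_half_turn\<close>).

  \<^bold>\<open>Sufficiency.\<close> If \<open>f\<close> is odd too, the system is reversible with respect to the \<open>y\<close>-axis. A half turn
  and its mirror image fit together to a closed orbit, by uniqueness of solutions
  (\<open>reversible_center_at_infinity\<close>).

  \<^bold>\<open>Necessity of the growth condition.\<close> If \<open>a m < 0\<close>, or if \<open>a m > 0\<close> and the growth condition fails,
  there is a curve \<open>y = h x \<ge> 0\<close>, \<open>x \<ge> X\<close>, that the flow crosses upwards only, possibly after the
  change \<open>(y, t) \<mapsto> (- y, - t)\<close>. Above it \<open>x\<close> increases for ever, so orbits that start on it are not
  closed (\<open>no_closed_orbit_through_barrier\<close>). In the second case \<open>h x = A x ^ (n + 1) + x ^ n sqrt x\<close>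
  works. The second summand decides the critical case \<open>4 (n + 1) (a m) = (b n)\<^sup>2\<close>, in which the
  leading terms cancel.

  \<^bold>\<open>Necessity of oddness of \<open>f\<close>.\<close> The reflection \<open>(x, t) \<mapsto> (- x, - t)\<close> turns left half turns of the
  system with damping \<open>f\<close> into right half turns of the system with damping \<open>f2 x = - f (- x)\<close>. The
  difference \<open>f x - f2 x\<close> is twice the even part of \<open>f\<close>. If it does not vanish, it has a constant sign
  far out, say positive, and then its integral over \<open>[0, X]\<close> is positive for a large \<open>X\<close>.
  Comparing two far half turns of the two systems from the same point as graphs over the \<open>x\<close>-axis
  shows that the system with damping \<open>f\<close> ends nearer to the origin (\<open>half_turn_comparison\<close>). Starting from the lowest point of a far closed orbit on the \<open>y\<close>-axis, going
  backwards through the right and then the left half-plane, one would arrive at a still lower point of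
  the same orbit.
\<close>

section \<open>Autonomous differential equations with a Lipschitz right-hand side\<close>

lemma has_vector_derivative_reflect:
  fixes f :: "real \<Rightarrow> 'a::real_normed_vector"
  assumes "(f has_vector_derivative f') (at (c - t))"
  shows "((\<lambda>t. f (c - t)) has_vector_derivative - f') (at t)"
proof -
  have "((\<lambda>t. c - t) has_vector_derivative - 1) (at t)"
    by (auto intro!: derivative_eq_intros)
  from vector_diff_chain_at[OF this assms] show ?thesis by (simp add: o_def)
qed

lemma has_vector_derivative_shift:
  fixes f :: "real \<Rightarrow> 'a::real_normed_vector"
  assumes "(f has_vector_derivative f') (at (c + t))"
  shows "((\<lambda>t. f (c + t)) has_vector_derivative f') (at t)"
proof -
  have "((\<lambda>t. c + t) has_vector_derivative 1) (at t)"
    by (auto intro!: derivative_eq_intros)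
  from vector_diff_chain_at[OF this assms] show ?thesis by (simp add: o_def)
qed

lemma periodic_representative:
  fixes \<gamma> :: "real \<Rightarrow> 'a"
  assumes T: "0 < T" and per: "\<And>t. \<gamma> (t + T) = \<gamma> t"
  obtains s where "a \<le> s" "s < a + T" "\<gamma> s = \<gamma> t"
proof -
  interpret periodic_fun_simple \<gamma> T by unfold_locales (rule per)
  define n where "n = \<lfloor>(t - a) / T\<rfloor>"
  have "of_int n \<le> (t - a) / T" "(t - a) / T < of_int n + 1" by (simp_all add: n_def)
  then have "a \<le> t - of_int n * T" "t - of_int n * T < a + T" using T by (simp_all add: field_simps)
  moreover have "\<gamma> (t - of_int n * T) = \<gamma> t" by (rule minus_of_int)
  ultimately show ?thesis using that by blast
qed

lemma continuous_has_primitive: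
  fixes h :: "real \<Rightarrow> 'a::euclidean_space"
  assumes h: "continuous_on UNIV h"
  shows "\<exists>H. H 0 = 0 \<and> (\<forall>t. (H has_vector_derivative h t) (at t))"
proof -
  define H where "H t = (if 0 \<le> t then integral {0..t} h else - integral {t..0} h)" for t :: real
  have int: "h integrable_on {a..b}" for a b
    using h continuous_on_subset integrable_continuous_real by blast
  have "(H has_vector_derivative h t) (at t)" for t
  proof -
    define A where "A = \<bar>t\<bar> + 1"
    have tA: "t \<in> {-A<..<A}" and A0: "0 < A" by (auto simp: A_def)
    have eq: "integral {-A..s} h - integral {-A..0} h = H s" if "s \<in> {-A<..<A}" for s
    proof (cases "0 \<le> s")
      case True
      then show ?thesis
        using Henstock_Kurzweil_Integration.integral_combine[of "-A" 0 s h] int A0 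
        by (auto simp: H_def algebra_simps)
    next
      case False
      then show ?thesis
        using Henstock_Kurzweil_Integration.integral_combine[of "-A" s 0 h] int A0 that
        by (auto simp: H_def algebra_simps)
    qed
    have "((\<lambda>s. integral {-A..s} h) has_vector_derivative h t) (at t within {-A..A})"
      using tA by (intro integral_has_vector_derivative continuous_on_subset[OF h]) auto
    then have "((\<lambda>s. integral {-A..s} h) has_vector_derivative h t) (at t within {-A<..<A})"
      by (rule has_vector_derivative_within_subset) auto
    then have "((\<lambda>s. integral {-A..s} h - integral {-A..0} h) has_vector_derivative h t - 0) (at t within {-A<..<A})"
      by (intro derivative_intros)
    then have "((\<lambda>s. integral {-A..s} h - integral {-A..0} h) has_vector_derivative h t) (at t)"
      using tA at_within_open[of t "{-A<..<A}"] by auto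
    then show ?thesis
      by (rule has_vector_derivative_transform_within_open[where S="{-A<..<A}"]) (use tA eq in auto)
  qed
  moreover have "H 0 = 0" by (simp add: H_def)
  ultimately show ?thesis by blast
qed

text \<open>
  The estimate that shows both boundedness and contractivity of the Picard operator in the weighted
  norm.
\<close>

lemma norm_bound_from_derivative_exp:
  fixes D :: "real \<Rightarrow> 'a::euclidean_space"
  assumes D0: "D 0 = 0" and K: "0 < K"
    and D: "\<And>t. (D has_vector_derivative d t) (at t)"
    and d: "\<And>t. norm (d t) \<le> c * exp (K * \<bar>t\<bar>)"
  shows "norm (D t) \<le> c / K * exp (K * \<bar>t\<bar>)"
proof -
  have c: "0 \<le> c" using order_trans[OF norm_ge_zero d[of 0]] by simp
  have forward: "norm (E t) \<le> c / K * exp (K * t)"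
    if E0: "E 0 = 0" and E: "\<And>t. (E has_vector_derivative e t) (at t)"
      and e: "\<And>t. norm (e t) \<le> c * exp (K * \<bar>t\<bar>)" and t: "0 < t"
    for E :: "real \<Rightarrow> 'a" and e t
  proof -
    have "norm (E t - E 0) \<le> c / K * exp (K * t) - c / K * exp (K * 0)"
    proof (rule differentiable_bound_general[where f'=e and \<phi>'="\<lambda>x. c * exp (K * x)"])
      show "continuous_on {0..t} E"
        using E by (intro continuous_at_imp_continuous_on) (auto intro: has_vector_derivative_continuous)
      show "((\<lambda>a. c / K * exp (K * a)) has_vector_derivative c * exp (K * x)) (at x)" for x
        unfolding has_real_derivative_iff_has_vector_derivative[symmetric]
        using K by (auto intro!: derivative_eq_intros)
      show "norm (e x) \<le> c * exp (K * x)" if "0 < x" for x using e[of x] that by simp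
    qed (use t E K in \<open>auto intro!: continuous_intros\<close>)
    then show ?thesis using E0 divide_nonneg_pos[OF c K] by simp
  qed
  consider "t = 0" | "0 < t" | "t < 0" by linarith
  then show ?thesis
  proof cases
    case 1 then show ?thesis using D0 c K by simp
  next
    case 2 then show ?thesis using forward[OF D0 D d] by simp
  next
    case 3
    have E: "((\<lambda>t. D (- t)) has_vector_derivative - d (- t)) (at t)" for t
      using has_vector_derivative_reflect[of D "d (- t)" 0 t] D[of "- t"] by simp
    show ?thesis using forward[of "\<lambda>t. D (-t)", OF _ E, of "-t"] d[of "- _"] D0 3 by simp
  qed
qed

text \<open>
  Picard iteration on the whole line at once. The unknown is \<open>y t = exp (- K \<bar>t\<bar>) (\<gamma> t - p)\<close>, a bounded
  continuous function, and \<open>K = 2 L + 1\<close> makes the integral operator a contraction in the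
  supremum norm.
\<close>

lemma lipschitz_ode_global_solution:
  fixes Y :: "'a::euclidean_space \<Rightarrow> 'a"
  assumes lip: "L-lipschitz_on UNIV Y" and bnd: "\<And>p. norm (Y p) \<le> B"
  shows "\<exists>\<gamma>. \<gamma> 0 = p \<and> (\<forall>t. (\<gamma> has_vector_derivative Y (\<gamma> t)) (at t))"
proof -
  have L: "0 \<le> L" using lip by (rule lipschitz_on_nonneg)
  have B: "0 \<le> B" using bnd[of 0] norm_ge_zero[of "Y 0"] by linarith
  define K where "K = 2 * L + 1"
  have K: "0 < K" "L / K \<le> 1/2" using L by (auto simp: K_def field_simps)
  define prim where "prim h = (SOME H. H 0 = 0 \<and> (\<forall>t. (H has_vector_derivative h t) (at t)))"
    for h :: "real \<Rightarrow> 'a"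
  have prim: "prim h 0 = 0" "\<And>t. (prim h has_vector_derivative h t) (at t)"
    if "continuous_on UNIV h" for h
    using someI_ex[OF continuous_has_primitive[OF that]] unfolding prim_def by blast+
  define w where "w = (\<lambda>(y::real \<Rightarrow>\<^sub>C 'a) s. Y (p + exp (K * \<bar>s\<bar>) *\<^sub>R apply_bcontfun y s))"
  have Yc: "continuous_on UNIV Y"
    using lip lipschitz_on_continuous_on by blast
  have wc: "continuous_on UNIV (w y)" for y
    unfolding w_def by (rule continuous_on_compose2[OF Yc]) (auto intro!: continuous_intros)
  define F where "F y = (\<lambda>t. exp (- (K * \<bar>t\<bar>)) *\<^sub>R prim (w y) t)" for y
  have primc: "continuous_on UNIV (prim (w y))" for y
    using prim(2)[OF wc] by (intro continuous_at_imp_continuous_on) (auto intro: has_vector_derivative_continuous)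
  have F: "F y \<in> bcontfun" for y
  proof (rule bcontfun_normI)
    show "continuous_on UNIV (F y)" unfolding F_def by (intro continuous_intros primc)
    have "norm (prim (w y) t) \<le> B / K * exp (K * \<bar>t\<bar>)" for t
    proof (rule norm_bound_from_derivative_exp[OF prim(1)[OF wc] K(1) prim(2)[OF wc]])
      show "norm (w y t) \<le> B * exp (K * \<bar>t\<bar>)" for t
        using bnd[of "p + exp (K * \<bar>t\<bar>) *\<^sub>R apply_bcontfun y t"] B K
          mult_left_mono[of 1 "exp (K * \<bar>t\<bar>)" B]
        by (simp add: w_def)
    qed
    then show "norm (F y t) \<le> B / K" for t
      by (simp add: F_def exp_minus field_simps)
  qed
  have contr: "dist (Bcontfun (F y)) (Bcontfun (F z)) \<le> 1/2 * dist y z" for y z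
  proof (rule dist_bound)
    fix t
    have "norm (prim (w y) t - prim (w z) t) \<le> (L * dist y z) / K * exp (K * \<bar>t\<bar>)"
    proof (rule norm_bound_from_derivative_exp[where d="\<lambda>t. w y t - w z t"])
      show "((\<lambda>t. prim (w y) t - prim (w z) t) has_vector_derivative w y t - w z t) (at t)" for t
        by (intro derivative_intros prim wc)
      show "norm (w y t - w z t) \<le> L * dist y z * exp (K * \<bar>t\<bar>)" for t
      proof -
        have "norm (w y t - w z t) \<le> L * norm (exp (K * \<bar>t\<bar>) *\<^sub>R apply_bcontfun y t - exp (K * \<bar>t\<bar>) *\<^sub>R apply_bcontfun z t)"
          using lipschitz_on_normD[OF lip, of "p + exp (K * \<bar>t\<bar>) *\<^sub>R apply_bcontfun y t" "p + exp (K * \<bar>t\<bar>) *\<^sub>R apply_bcontfun z t"]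
          by (simp add: w_def)
        also have "\<dots> = L * (exp (K * \<bar>t\<bar>) * dist (apply_bcontfun y t) (apply_bcontfun z t))"
          by (simp add: scaleR_right_diff_distrib[symmetric] dist_norm)
        also have "\<dots> \<le> L * (exp (K * \<bar>t\<bar>) * dist y z)"
          using L by (intro mult_left_mono) (auto intro: dist_bounded)
        finally show ?thesis by (simp add: mult_ac)
      qed
    qed (use K prim(1)[OF wc] in auto)
    moreover have "dist (F y t) (F z t) = exp (- (K * \<bar>t\<bar>)) * norm (prim (w y) t - prim (w z) t)"
      by (simp add: F_def dist_norm scaleR_right_diff_distrib[symmetric])
    ultimately have "dist (F y t) (F z t)
        \<le> exp (- (K * \<bar>t\<bar>)) * ((L * dist y z) / K * exp (K * \<bar>t\<bar>))"
      by (metis exp_ge_zero mult_left_mono)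
    also have "\<dots> = L / K * dist y z"
      by (simp add: exp_minus)
    also have "\<dots> \<le> 1/2 * dist y z"
      using K by (intro mult_right_mono) auto
    finally show "dist (apply_bcontfun (Bcontfun (F y)) t) (apply_bcontfun (Bcontfun (F z)) t) \<le> 1/2 * dist y z"
      using F by (simp add: Bcontfun_inverse)
  qed
  obtain y where y: "Bcontfun (F y) = y"
    using banach_fix_type[of "1/2" "\<lambda>y. Bcontfun (F y)"] contr by auto
  then have yt: "apply_bcontfun y t = F y t" for t
    using F Bcontfun_inverse by metis
  define \<gamma> where "\<gamma> t = p + prim (w y) t" for t
  have "w y t = Y (\<gamma> t)" for t
  proof -
    have "w y t = Y (p + exp (K * \<bar>t\<bar>) *\<^sub>R F y t)" by (simp add: w_def yt)
    then show ?thesis by (simp add: \<gamma>_def F_def exp_minus)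
  qed
  then have "(\<gamma> has_vector_derivative Y (\<gamma> t)) (at t)" for t
    using prim(2)[OF wc, of y t] unfolding \<gamma>_def
    by (auto intro!: derivative_eq_intros)
  moreover have "\<gamma> 0 = p" by (simp add: \<gamma>_def prim(1)[OF wc])
  ultimately show ?thesis by blast
qed

lemma lipschitz_ode_unique:
  fixes Y :: "'a::euclidean_space \<Rightarrow> 'a"
  assumes lip: "L-lipschitz_on UNIV Y"
    and \<gamma>: "\<And>t. (\<gamma> has_vector_derivative Y (\<gamma> t)) (at t)"
    and \<delta>: "\<And>t. (\<delta> has_vector_derivative Y (\<delta> t)) (at t)"
    and eq: "\<gamma> a = \<delta> a"
  shows "\<gamma> t = \<delta> t"
proof -
  \<comment> \<open>Gronwall: \<open>\<bar>v'\<bar> \<le> 2 L v\<close> for the squared distance, so \<open>exp (- 2 L t) v t\<close> decreases and \<open>exp (2 L t) v t\<close> increases.\<close>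
  define v where "v t = (\<gamma> t - \<delta> t) \<bullet> (\<gamma> t - \<delta> t)" for t
  define v' where "v' t = 2 * ((\<gamma> t - \<delta> t) \<bullet> (Y (\<gamma> t) - Y (\<delta> t)))" for t
  have v: "(v has_real_derivative v' t) (at t)" for t
  proof -
    have *: "((\<lambda>t. \<gamma> t - \<delta> t) has_derivative (\<lambda>x. x *\<^sub>R (Y (\<gamma> t) - Y (\<delta> t)))) (at t)"
      using has_vector_derivative_diff[OF \<gamma> \<delta>] unfolding has_vector_derivative_def .
    show ?thesis
      unfolding v_def v'_def has_field_derivative_def
      by (rule has_derivative_eq_rhs[OF has_derivative_inner[OF * *]])
         (auto simp: inner_commute fun_eq_iff algebra_simps)
  qed
  have v'b: "\<bar>v' t\<bar> \<le> 2 * L * v t" for t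
  proof -
    have "\<bar>(\<gamma> t - \<delta> t) \<bullet> (Y (\<gamma> t) - Y (\<delta> t))\<bar> \<le> norm (\<gamma> t - \<delta> t) * norm (Y (\<gamma> t) - Y (\<delta> t))"
      by (rule Cauchy_Schwarz_ineq2)
    also have "\<dots> \<le> norm (\<gamma> t - \<delta> t) * (L * norm (\<gamma> t - \<delta> t))"
      by (intro mult_left_mono lipschitz_on_normD[OF lip]) auto
    also have "\<dots> = L * v t" by (simp add: v_def dot_square_norm power2_eq_square)
    finally show ?thesis by (simp add: v'_def)
  qed
  have v0: "0 \<le> v t" for t by (simp add: v_def)
  have va: "v a = 0" by (simp add: v_def eq)
  have "v t \<le> 0"
  proof (cases "a \<le> t")
    case True
    have "exp (- 2 * L * t) * v t \<le> exp (- 2 * L * a) * v a"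
    proof (rule DERIV_nonpos_imp_nonincreasing[OF True])
      fix x
      have "((\<lambda>x. exp (- 2 * L * x) * v x) has_real_derivative exp (- 2 * L * x) * (v' x - 2 * L * v x)) (at x)"
        by (auto intro!: derivative_eq_intros v simp: algebra_simps)
      moreover have "exp (- 2 * L * x) * (v' x - 2 * L * v x) \<le> 0"
        using v'b[of x] by (intro mult_nonneg_nonpos) auto
      ultimately show "\<exists>y. ((\<lambda>x. exp (- 2 * L * x) * v x) has_real_derivative y) (at x) \<and> y \<le> 0" by blast
    qed
    then show ?thesis using va by (simp add: mult_le_0_iff)
  next
    case False
    then have "t \<le> a" by simp
    have "exp (2 * L * t) * v t \<le> exp (2 * L * a) * v a"
    proof (rule DERIV_nonneg_imp_nondecreasing[OF \<open>t \<le> a\<close>])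
      fix x
      have "((\<lambda>x. exp (2 * L * x) * v x) has_real_derivative exp (2 * L * x) * (v' x + 2 * L * v x)) (at x)"
        by (auto intro!: derivative_eq_intros v simp: algebra_simps)
      moreover have "exp (2 * L * x) * (v' x + 2 * L * v x) \<ge> 0"
        using v'b[of x] by (intro mult_nonneg_nonneg) auto
      ultimately show "\<exists>y. ((\<lambda>x. exp (2 * L * x) * v x) has_real_derivative y) (at x) \<and> 0 \<le> y" by blast
    qed
    then show ?thesis using va by (simp add: mult_le_0_iff)
  qed
  then have "v t = 0" using v0[of t] by linarith
  then show ?thesis by (simp add: v_def)
qed

section \<open>Far orbits and the Poincare disc\<close>

lemma norm_poincare_projection:
  "norm (poincare_projection p) = norm p / sqrt (1 + (norm p)\<^sup>2)"
proof -
  obtain x y where p: "p = (x, y)" by (cases p)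
  have 1: "norm p = sqrt (x\<^sup>2 + y\<^sup>2)" by (simp add: p norm_prod_def)
  have "poincare_projection p = (1 / sqrt (1 + (x\<^sup>2 + y\<^sup>2))) *\<^sub>R p"
    by (simp add: p poincare_projection_eq add.assoc)
  then show ?thesis by (simp add: 1)
qed

lemma inj_poincare_projection: "inj poincare_projection"
proof (rule injI)
  fix p q assume "poincare_projection p = poincare_projection q"
  then have eq: "poincare_projection p = poincare_projection q" .
  have inv: "p = (1 / sqrt (1 - (norm (poincare_projection p))\<^sup>2)) *\<^sub>R poincare_projection p" for p
  proof -
    have pos: "0 < 1 + (norm p)\<^sup>2" by (smt (verit) zero_le_power2)
    have "1 - (norm (poincare_projection p))\<^sup>2 = 1 / (1 + (norm p)\<^sup>2)"
      using pos by (simp add: norm_poincare_projection power_divide field_simps)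
    then have "1 / sqrt (1 - (norm (poincare_projection p))\<^sup>2) = sqrt (1 + (norm p)\<^sup>2)"
      by (simp add: real_sqrt_divide)
    moreover have "poincare_projection p = (1 / sqrt (1 + (norm p)\<^sup>2)) *\<^sub>R p"
      by (cases p) (simp add: poincare_projection_eq norm_prod_def add.assoc)
    ultimately show ?thesis using pos by simp
  qed
  show "p = q" using inv[of p] inv[of q] eq by simp
qed

text \<open>
  If the orbits of all far points are closed, a neighbourhood of the circle together with the images
  of all closed orbits serves as \<open>U\<close>. The converse uses compactness of the closed disc.
\<close>

lemma center_at_infinity_iff:
  "center_at_infinity X \<longleftrightarrow> (\<exists>R. \<forall>p. R \<le> norm p \<longrightarrow> (\<exists>C. closed_orbit X C \<and> p \<in> C))"
proof
  assume "center_at_infinity X"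
  then obtain U V where V: "openin (top_of_set poincare_disc) V" "circle_at_infinity \<subseteq> V" "V \<subseteq> U"
    and U: "\<And>p. poincare_projection p \<in> U \<Longrightarrow> \<exists>C. closed_orbit X C \<and> p \<in> C"
    unfolding center_at_infinity_def by metis
  define K where "K = poincare_disc - V"
  have "closedin (top_of_set poincare_disc) K" unfolding K_def using V(1) by (metis closedin_diff closedin_topspace topspace_euclidean_subtopology)
  then have cK: "compact K"
    using closedin_compact compact_cball by blast
  obtain r where r: "r < 1" "\<And>q. q \<in> K \<Longrightarrow> norm q \<le> r"
  proof (cases "K = {}")
    case True then show ?thesis using that[of 0] by auto
  next
    case False
    obtain q where q: "q \<in> K" "\<And>q'. q' \<in> K \<Longrightarrow> norm q' \<le> norm q"
      using continuous_attains_sup[OF cK False, of norm] continuous_on_norm_id by blast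
    have "norm q \<noteq> 1" using q(1) V(2) by (auto simp: K_def)
    moreover have "norm q \<le> 1" using q(1) by (auto simp: K_def)
    ultimately show ?thesis using that[of "norm q"] q(2) by auto
  qed
  have "((\<lambda>R. R / sqrt (1 + R\<^sup>2)) \<longlongrightarrow> 1) at_top" by real_asymp
  then have "eventually (\<lambda>R. r < R / sqrt (1 + R\<^sup>2)) at_top"
    using r(1) by (rule order_tendstoD)
  then obtain R0 where R0: "\<And>R. R0 \<le> R \<Longrightarrow> r < R / sqrt (1 + R\<^sup>2)"
    unfolding eventually_at_top_linorder by blast
  have "\<exists>C. closed_orbit X C \<and> p \<in> C" if "R0 \<le> norm p" for p
  proof -
    have "r < norm (poincare_projection p)" using R0[OF that] by (simp add: norm_poincare_projection)
    moreover have "norm (poincare_projection p) \<le> 1"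
      by (auto simp: norm_poincare_projection divide_le_eq intro!: real_le_rsqrt)
         (smt (verit) zero_le_power2)
    ultimately have "poincare_projection p \<in> V"
      using r(2)[of "poincare_projection p"] by (auto simp: K_def)
    then show ?thesis using U V(3) by blast
  qed
  then show "\<exists>R. \<forall>p. R \<le> norm p \<longrightarrow> (\<exists>C. closed_orbit X C \<and> p \<in> C)" by blast
next
  assume "\<exists>R. \<forall>p. R \<le> norm p \<longrightarrow> (\<exists>C. closed_orbit X C \<and> p \<in> C)"
  then obtain R where R: "\<And>p. R \<le> norm p \<Longrightarrow> \<exists>C. closed_orbit X C \<and> p \<in> C" by blast
  define S where "S = max R 0"
  define V where "V = {q \<in> poincare_disc. S / sqrt (1 + S\<^sup>2) < norm q}"
  define W where "W = (\<Union>C \<in> Collect (closed_orbit X). poincare_projection ` C)"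
  have S0: "0 \<le> S" "R \<le> S" by (auto simp: S_def)
  have mono: "a / sqrt (1 + a\<^sup>2) \<le> b / sqrt (1 + b\<^sup>2)" if "0 \<le> a" "a \<le> b" for a b :: real
  proof -
    have "(a / sqrt (1 + a\<^sup>2))\<^sup>2 \<le> (b / sqrt (1 + b\<^sup>2))\<^sup>2"
    proof -
      have "a\<^sup>2 * (1 + b\<^sup>2) \<le> b\<^sup>2 * (1 + a\<^sup>2)"
        using power_mono[OF that(2,1), of 2] by (simp add: algebra_simps)
      moreover have "0 < 1 + a\<^sup>2" "0 < 1 + b\<^sup>2" by (smt (verit) zero_le_power2)+
      ultimately show ?thesis by (simp add: power_divide divide_le_eq le_divide_eq mult.commute)
    qed
    then show ?thesis by (rule power2_le_imp_le) (use that in simp)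
  qed
  have far: "R \<le> norm p" if "poincare_projection p \<in> V" for p
  proof (rule ccontr)
    assume "\<not> R \<le> norm p"
    then have "norm p \<le> S" using S0 by simp
    then have "norm (poincare_projection p) \<le> S / sqrt (1 + S\<^sup>2)"
      unfolding norm_poincare_projection by (intro mono) auto
    then show False using that by (simp add: V_def)
  qed
  have less1: "norm (poincare_projection p) \<le> 1" for p
    by (auto simp: norm_poincare_projection divide_le_eq intro!: real_le_rsqrt)
       (smt (verit) zero_le_power2)
  have "open {q::real\<times>real. S / sqrt (1 + S\<^sup>2) < norm q}"
    by (intro open_Collect_less continuous_intros)
  then have 1: "openin (top_of_set poincare_disc) V"
    unfolding openin_open V_def by blast
  have "S / sqrt (1 + S\<^sup>2) < 1"
    using S0 by (auto simp: divide_less_eq add_pos_nonneg intro!: real_less_rsqrt)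
  then have 2: "circle_at_infinity \<subseteq> V" by (auto simp: V_def)
  have 3: "V \<union> W \<subseteq> poincare_disc" using less1 by (auto simp: V_def W_def)
  have 4: "\<exists>C. closed_orbit X C \<and> p \<in> C \<and> poincare_projection ` C \<subseteq> V \<union> W"
    if "poincare_projection p \<in> V \<union> W" for p
  proof -
    have "\<exists>C. closed_orbit X C \<and> p \<in> C"
    proof (cases "poincare_projection p \<in> V")
      case True then show ?thesis using R[OF far] by blast
    next
      case False
      then have "poincare_projection p \<in> W" using that by blast
      then show ?thesis unfolding W_def using inj_poincare_projection by (auto simp: inj_image_mem_iff)
    qed
    then show ?thesis unfolding W_def by blast
  qed
  show "center_at_infinity X"
    unfolding center_at_infinity_def using 1 2 3 4 by (metis Un_upper1)
qed

section \<open>Reflections of the phase plane\<close>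

text \<open>
  A linear injection that reverses the direction of the vector fields maps closed orbits to closed
  orbits, run backwards.
\<close>

lemma closed_orbit_time_reversal:
  assumes C: "closed_orbit X C" and A: "bounded_linear A" "inj A"
    and rev: "\<And>p. Y (A p) = - A (X p)"
  shows "closed_orbit Y (A ` C)"
proof -
  obtain \<gamma> T where \<gamma>: "\<And>t. (\<gamma> has_vector_derivative X (\<gamma> t)) (at t)" and T: "0 < T"
    and per: "\<And>t. \<gamma> (t + T) = \<gamma> t" and nc: "\<not> \<gamma> constant_on UNIV" and C: "C = range \<gamma>"
    using C unfolding closed_orbit_def by blast
  have "((\<lambda>t. A (\<gamma> (- t))) has_vector_derivative Y (A (\<gamma> (- t)))) (at t)" for t
    using bounded_linear.has_vector_derivative[OF A(1) has_vector_derivative_reflect[of \<gamma> "X (\<gamma> (- t))" 0 t]] \<gamma>[of "- t"]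
    by (simp add: rev linear_neg[OF bounded_linear.linear[OF A(1)]])
  moreover have "A (\<gamma> (- (t + T))) = A (\<gamma> (- t))" for t using per[of "- (t + T)"] by simp
  moreover have "\<not> (\<lambda>t. A (\<gamma> (- t))) constant_on UNIV"
    using nc A(2) unfolding constant_on_def by (metis UNIV_I add.inverse_inverse injD)
  moreover have "A ` C = range (\<lambda>t. A (\<gamma> (- t)))"
    proof -
      have "range (\<lambda>t. A (\<gamma> (- t))) = (\<lambda>t. A (\<gamma> t)) ` range uminus" by (simp only: image_image)
      then show ?thesis unfolding C by (simp add: image_image)
    qed
  ultimately show ?thesis
    unfolding closed_orbit_def using T by (intro exI[of _ "\<lambda>t. A (\<gamma> (- t))"] exI[of _ T]) auto
qed

text \<open>
  The reflections in the two coordinate axes. Combined with a reversal of time, \<open>mirror\<close> (in the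
  \<open>y\<close>-axis) replaces \<open>f x\<close> by \<open>- f (- x)\<close> if \<open>g\<close> is odd, and \<open>flip\<close> (in the \<open>x\<close>-axis) replaces \<open>f\<close> by
  \<open>- f\<close>.
\<close>

definition mirror :: "real \<times> real \<Rightarrow> real \<times> real" where
  "mirror p = (- fst p, snd p)"

definition flip :: "real \<times> real \<Rightarrow> real \<times> real" where
  "flip p = (fst p, - snd p)"

lemma mirror_simps [simp]: "mirror (x, y) = (- x, y)" "mirror (mirror p) = p"
    "fst (mirror p) = - fst p" "snd (mirror p) = snd p"
  and flip_simps [simp]: "flip (x, y) = (x, - y)" "flip (flip p) = p"
    "fst (flip p) = fst p" "snd (flip p) = - snd p"
  by (simp_all add: mirror_def flip_def)

lemma bounded_linear_mirror: "bounded_linear mirror"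
  unfolding mirror_def
  by (intro bounded_linear_Pair bounded_linear_minus bounded_linear_fst bounded_linear_snd)

lemma bounded_linear_flip: "bounded_linear flip"
  unfolding flip_def
  by (intro bounded_linear_Pair bounded_linear_minus bounded_linear_fst bounded_linear_snd)

lemma norm_mirror [simp]: "norm (mirror p) = norm p" and norm_flip [simp]: "norm (flip p) = norm p"
  by (simp_all add: mirror_def flip_def norm_prod_def)

lemma lienard_Pair [simp]: "lienard g f (x, y) = (y, - g x - f x * y)"
  by (simp add: lienard_def)

lemma lienard_mirror:
  assumes "odd_fun g"
  shows "lienard g (\<lambda>x. - f (- x)) (mirror p) = - mirror (lienard g f p)"
  using assms by (cases p) (simp add: odd_fun_def)

lemma lienard_flip: "lienard g (\<lambda>x. - f x) (flip p) = - flip (lienard g f p)"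
  by (cases p) simp

lemma inj_mirror: "inj mirror" and inj_flip: "inj flip"
  by (metis mirror_simps(2) injI, metis flip_simps(2) injI)

lemma center_at_infinity_mirror:
  assumes "odd_fun g" "center_at_infinity (lienard g f)"
  shows "center_at_infinity (lienard g (\<lambda>x. - f (- x)))"
proof -
  obtain R where R: "\<And>p. R \<le> norm p \<Longrightarrow> \<exists>C. closed_orbit (lienard g f) C \<and> p \<in> C"
    using assms(2) unfolding center_at_infinity_iff by blast
  have "\<exists>C. closed_orbit (lienard g (\<lambda>x. - f (- x))) C \<and> p \<in> C" if p: "R \<le> norm p" for p
  proof -
    obtain C where C: "closed_orbit (lienard g f) C" "mirror p \<in> C" using R[of "mirror p"] p by auto
    have "closed_orbit (lienard g (\<lambda>x. - f (- x))) (mirror ` C)"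
      using closed_orbit_time_reversal[where Y="lienard g (\<lambda>x. - f (- x))", OF C(1) bounded_linear_mirror inj_mirror]
        lienard_mirror[OF assms(1), of f] by blast
    moreover have "p \<in> mirror ` C" by (rule image_eqI[OF _ C(2)]) simp
    ultimately show ?thesis by blast
  qed
  then show ?thesis unfolding center_at_infinity_iff by blast
qed

lemma center_at_infinity_flip:
  assumes "center_at_infinity (lienard g f)"
  shows "center_at_infinity (lienard g (\<lambda>x. - f x))"
proof -
  obtain R where R: "\<And>p. R \<le> norm p \<Longrightarrow> \<exists>C. closed_orbit (lienard g f) C \<and> p \<in> C"
    using assms unfolding center_at_infinity_iff by blast
  have "\<exists>C. closed_orbit (lienard g (\<lambda>x. - f x)) C \<and> p \<in> C" if p: "R \<le> norm p" for p
  proof -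
    obtain C where C: "closed_orbit (lienard g f) C" "flip p \<in> C" using R[of "flip p"] p by auto
    have "closed_orbit (lienard g (\<lambda>x. - f x)) (flip ` C)"
      using closed_orbit_time_reversal[where Y="lienard g (\<lambda>x. - f x)", OF C(1) bounded_linear_flip inj_flip]
        lienard_flip[of g f] by blast
    moreover have "p \<in> flip ` C" by (rule image_eqI[OF _ C(2)]) simp
    ultimately show ?thesis by blast
  qed
  then show ?thesis unfolding center_at_infinity_iff by blast
qed

lemma lienard_solution_components:
  assumes "(\<gamma> has_vector_derivative lienard g f (\<gamma> t)) (at t)"
  shows "((\<lambda>t. fst (\<gamma> t)) has_real_derivative snd (\<gamma> t)) (at t)"
    and "((\<lambda>t. snd (\<gamma> t)) has_real_derivative - g (fst (\<gamma> t)) - f (fst (\<gamma> t)) * snd (\<gamma> t)) (at t)"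
  using bounded_linear.has_vector_derivative[OF bounded_linear_fst assms]
    bounded_linear.has_vector_derivative[OF bounded_linear_snd assms]
  by (cases "\<gamma> t", simp add: has_real_derivative_iff_has_vector_derivative)+

lemma closed_orbit_cases:
  assumes "closed_orbit X C" "p \<in> C"
  obtains \<gamma> T where "\<And>t. (\<gamma> has_vector_derivative X (\<gamma> t)) (at t)" "0 < T"
    "\<And>t. \<gamma> (t + T) = \<gamma> t" "\<gamma> 0 = p" "C = range \<gamma>"
proof -
  obtain \<gamma> T where \<gamma>: "\<And>t. (\<gamma> has_vector_derivative X (\<gamma> t)) (at t)" and T: "0 < T"
    and per: "\<And>t. \<gamma> (t + T) = \<gamma> t" and C: "C = range \<gamma>"
    using assms unfolding closed_orbit_def by blast
  obtain a where a: "\<gamma> a = p" using assms(2) C by blast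
  show ?thesis
  proof
    show "((\<lambda>t. \<gamma> (a + t)) has_vector_derivative X (\<gamma> (a + t))) (at t)" for t
      by (rule has_vector_derivative_shift[OF \<gamma>])
    show "0 < T" by (rule T)
    show "\<gamma> (a + (t + T)) = \<gamma> (a + t)" for t using per[of "a + t"] by (simp add: add.assoc)
    show "\<gamma> (a + 0) = p" using a by simp
    show "C = range (\<lambda>t. \<gamma> (a + t))"
      proof -
      have "range (\<lambda>t. \<gamma> (a + t)) = \<gamma> ` range ((+) a)" by (simp only: image_image)
      then show ?thesis unfolding C by simp
    qed
  qed
qed

section \<open>Orbits above a barrier curve\<close>

text \<open>
  At a point of the curve \<open>y = h x\<close> the difference \<open>y - h x\<close> grows along the flow, so the region above
  the curve is never left to the future. There \<open>x\<close> does not decrease, and it increases strictly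
  at the start. The hypotheses extend to the left of \<open>x0\<close> because the proof needs \<open>h\<close> to be
  differentiable and nonnegative on a neighbourhood of \<open>x0\<close>.
\<close>

lemma no_closed_orbit_through_barrier:
  assumes h: "\<And>x. x1 \<le> x \<Longrightarrow> (h has_real_derivative h' x) (at x)"
    and h0: "\<And>x. x1 \<le> x \<Longrightarrow> 0 \<le> h x"
    and barrier: "\<And>x. x1 \<le> x \<Longrightarrow> h' x * h x < - g x - f x * h x"
    and x1: "x1 < x0"
    and C: "closed_orbit (lienard g f) C"
  shows "(x0, h x0) \<notin> C"
proof
  assume "(x0, h x0) \<in> C"
  then obtain \<gamma> T where \<gamma>: "\<And>t. (\<gamma> has_vector_derivative lienard g f (\<gamma> t)) (at t)" and T: "0 < T"
    and per: "\<And>t. \<gamma> (t + T) = \<gamma> t" and \<gamma>0: "\<gamma> 0 = (x0, h x0)"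
    using closed_orbit_cases[OF C] by metis
  define x where "x t = fst (\<gamma> t)" for t
  define y where "y t = snd (\<gamma> t)" for t
  define \<phi> where "\<phi> t = y t - h (x t)" for t
  have dx: "(x has_real_derivative y t) (at t)" for t
    unfolding x_def y_def by (rule lienard_solution_components[OF \<gamma>])
  have dy: "(y has_real_derivative - g (x t) - f (x t) * y t) (at t)" for t
    unfolding x_def y_def by (rule lienard_solution_components[OF \<gamma>])
  have d\<phi>: "(\<phi> has_real_derivative - g (x t) - f (x t) * y t - h' (x t) * y t) (at t)"
    if "x1 \<le> x t" for t
    unfolding \<phi>_def using DERIV_chain2[OF h[OF that] dx] dy
    by (auto intro!: derivative_eq_intros)
  have \<phi>pos: "0 < - g (x t) - f (x t) * y t - h' (x t) * y t" if "x1 \<le> x t" "\<phi> t = 0" for t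
    using barrier[OF that(1)] that(2) by (simp add: \<phi>_def)
  have start: "x 0 = x0" "\<phi> 0 = 0" by (simp_all add: x_def y_def \<phi>_def \<gamma>0)
  have cx: "isCont x t" for t using dx DERIV_isCont by blast
  have increase: "\<exists>d>0. \<forall>s. \<tau> < s \<and> s < \<tau> + d \<longrightarrow> 0 < \<phi> s" if x\<tau>: "x1 \<le> x \<tau>" and \<phi>\<tau>: "0 \<le> \<phi> \<tau>" for \<tau>
  proof (cases "\<phi> \<tau> = 0")
    case True
    obtain d where d: "0 < d" "\<And>h. 0 < h \<Longrightarrow> h < d \<Longrightarrow> \<phi> \<tau> < \<phi> (\<tau> + h)"
      using DERIV_pos_inc_right[OF d\<phi>[OF x\<tau>] \<phi>pos[OF x\<tau> True]] by blast
    have "0 < \<phi> s" if "\<tau> < s" "s < \<tau> + d" for s using d(2)[of "s - \<tau>"] that True by simp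
    then show ?thesis using d(1) by blast
  next
    case False
    then have "0 < \<phi> \<tau>" using \<phi>\<tau> by simp
    then have "\<forall>\<^sub>F s in at \<tau>. 0 < \<phi> s"
      using DERIV_isCont[OF d\<phi>[OF x\<tau>]] by (auto simp: isCont_def intro: order_tendstoD)
    then obtain d where "0 < d" "\<And>s. s \<noteq> \<tau> \<Longrightarrow> dist s \<tau> < d \<Longrightarrow> 0 < \<phi> s"
      unfolding eventually_at by auto
    then show ?thesis by (intro exI[of _ d]) (auto simp: dist_real_def)
  qed
  \<comment> \<open>The times up to which the orbit has remained in the region \<open>x \<ge> x0\<close>, \<open>y \<ge> h x\<close>.\<close>
  define J where "J = {t. 0 \<le> t \<and> (\<forall>s\<in>{0..t}. x0 \<le> x s \<and> 0 \<le> \<phi> s)}"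
  have J0: "0 \<in> J" using start by (auto simp: J_def)
  have J: "t \<in> J" if "0 \<le> t" for t
  proof (rule ccontr)
    assume nt: "t \<notin> J"
    define \<tau> where "\<tau> = Sup J"
    have bdd: "s \<le> t" if "s \<in> J" for s
    proof (rule ccontr)
      assume "\<not> s \<le> t"
      then have "t \<in> J" using that \<open>0 \<le> t\<close> by (simp add: J_def)
      then show False using nt by simp
    qed
    have bdd': "bdd_above J" using bdd by (auto simp: bdd_above_def)
    have \<tau>0: "0 \<le> \<tau>" unfolding \<tau>_def by (rule cSup_upper[OF J0 bdd'])
    have before: "x0 \<le> x s \<and> 0 \<le> \<phi> s" if "0 \<le> s" and s\<tau>: "s < \<tau>" for s
    proof -
      obtain s' where "s' \<in> J" "s < s'" using less_cSupE[of s J] s\<tau> J0 unfolding \<tau>_def by blast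
      then show ?thesis using that by (auto simp: J_def)
    qed
    have x\<tau>: "x0 \<le> x \<tau>"
    proof (cases "\<tau> = 0")
      case False
      show ?thesis
      proof (rule tendsto_lowerbound)
        show "(x \<longlongrightarrow> x \<tau>) (at_left \<tau>)" using cx[of \<tau>] by (simp add: isCont_def filterlim_at_split)
        show "\<forall>\<^sub>F s in at_left \<tau>. x0 \<le> x s"
          using eventually_at_left_real[of 0 \<tau>] False \<tau>0 before by (auto elim: eventually_mono)
      qed simp
    qed (use start in simp)
    have \<phi>c: "isCont \<phi> \<tau>" using d\<phi>[of \<tau>] x\<tau> x1 DERIV_isCont by force
    have \<phi>\<tau>: "0 \<le> \<phi> \<tau>"
    proof (cases "\<tau> = 0")
      case False
      show ?thesis
      proof (rule tendsto_lowerbound)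
        show "(\<phi> \<longlongrightarrow> \<phi> \<tau>) (at_left \<tau>)" using \<phi>c by (simp add: isCont_def filterlim_at_split)
        show "\<forall>\<^sub>F s in at_left \<tau>. 0 \<le> \<phi> s"
          using eventually_at_left_real[of 0 \<tau>] False \<tau>0 before by (auto elim: eventually_mono)
      qed simp
    qed (use start in simp)
    obtain d where d: "0 < d" "\<And>s. \<tau> < s \<Longrightarrow> s < \<tau> + d \<Longrightarrow> 0 < \<phi> s"
      using increase[of \<tau>] x\<tau> \<phi>\<tau> x1 by auto
    have "\<forall>\<^sub>F s in at \<tau>. x1 < x s"
      using cx[of \<tau>] x\<tau> x1 by (auto simp: isCont_def intro: order_tendstoD)
    then obtain e where e: "0 < e" "\<And>s. s \<noteq> \<tau> \<Longrightarrow> dist s \<tau> < e \<Longrightarrow> x1 < x s"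
      unfolding eventually_at by auto
    define r where "r = \<tau> + min d e / 2"
    have r: "\<tau> < r" "r < \<tau> + d" "r < \<tau> + e" using d e by (auto simp: r_def min_def field_simps)
    have xr: "x0 \<le> x s" if "\<tau> < s" "s \<le> r" for s
    proof -
      have "x \<tau> \<le> x s"
      proof (rule DERIV_nonneg_imp_increasing_open[where f=x])
        fix q assume q: "\<tau> < q" "q < s"
        have "0 < \<phi> q" "x1 < x q"
          using d(2)[of q] e(2)[of q] q r that by (auto simp: dist_real_def)
        then have "0 \<le> y q" using h0[of "x q"] by (simp add: \<phi>_def)
        then show "\<exists>y. (x has_real_derivative y) (at q) \<and> 0 \<le> y" using dx by blast
      qed (use that cx in \<open>auto intro: continuous_at_imp_continuous_on\<close>)
      then show ?thesis using x\<tau> by simp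
    qed
    have "r \<in> J"
      unfolding J_def
    proof (safe, goal_cases)
      case 1 then show ?case using \<tau>0 r by simp
    next
      case (2 s) then show ?case using before[of s] xr[of s] x\<tau> by force
    next
      case (3 s) then show ?case using before[of s] d(2)[of s] \<phi>\<tau> r by force
    qed
    then have "r \<le> \<tau>" unfolding \<tau>_def by (rule cSup_upper[OF _ bdd'])
    then show False using r by simp
  qed
  have xy: "x0 \<le> x t" "0 \<le> \<phi> t" if "0 \<le> t" for t using J[OF that] that by (auto simp: J_def)
  have y0: "0 \<le> y t" if "0 \<le> t" for t
    using xy[OF that] h0[of "x t"] x1 by (simp add: \<phi>_def)
  have mono: "x s \<le> x t" if "0 \<le> s" "s \<le> t" for s t
    using DERIV_nonneg_imp_nondecreasing[OF that(2), of x] dx y0 that(1) by (metis order_trans)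
  obtain d where d: "0 < d" "\<And>s. 0 < s \<Longrightarrow> s < d \<Longrightarrow> 0 < \<phi> s"
    using increase[of 0] start x1 by auto
  define s where "s = min d T / 2"
  have s: "0 < s" "s < d" "s < T" using d T by (auto simp: s_def min_def field_simps)
  have "0 < y s" using d(2)[of s] s h0[of "x s"] xy(1)[of s] x1 by (simp add: \<phi>_def)
  then obtain e where e: "0 < e" "\<And>q. 0 < q \<Longrightarrow> q < e \<Longrightarrow> x s < x (s + q)"
    using DERIV_pos_inc_right[OF dx] by blast
  define q where "q = min e (T - s) / 2"
  have q: "0 < q" "q < e" "s + q < T" using e s by (auto simp: q_def min_def field_simps)
  have "x s < x (s + q)" using e(2) q by simp
  also have "\<dots> \<le> x T" using mono[of "s + q" T] s q by simp
  also have "\<dots> = x0" using per[of 0] start by (simp add: x_def)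
  also have "\<dots> \<le> x s" using xy(1)[of s] s by simp
  finally show False by simp
qed

section \<open>Half turns in the right half-plane\<close>

lemma first_exit_time:
  fixes G :: "real set"
  assumes G: "closed G" "0 \<in> G" and ex: "0 \<le> b" "b \<notin> G"
  obtains \<tau> where "0 \<le> \<tau>" "\<tau> \<le> b" "{0..\<tau>} \<subseteq> G" "\<And>e. 0 < e \<Longrightarrow> \<exists>s. \<tau> < s \<and> s < \<tau> + e \<and> s \<notin> G"
proof -
  define B where "B = {0..} - G"
  define \<tau> where "\<tau> = Inf B"
  have ne: "B \<noteq> {}" using ex by (auto simp: B_def)
  have bd: "bdd_below B" by (auto simp: B_def bdd_below_def)
  have \<tau>0: "0 \<le> \<tau>" unfolding \<tau>_def using ne by (intro cInf_greatest) (auto simp: B_def)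
  have \<tau>b: "\<tau> \<le> b" unfolding \<tau>_def using ex by (intro cInf_lower bd) (auto simp: B_def)
  have before: "s \<in> G" if "0 \<le> s" "s < \<tau>" for s
    using that cInf_lower[OF _ bd, of s] by (auto simp: \<tau>_def B_def not_le[symmetric])
  have \<tau>G: "\<tau> \<in> G"
  proof (cases "\<tau> = 0")
    case False
    then have "closure {0..<\<tau>} = {0..\<tau>}" using \<tau>0 by simp
    moreover have "closure {0..<\<tau>} \<subseteq> G" using before by (intro closure_minimal G) auto
    ultimately show ?thesis using \<tau>0 by auto
  qed (use G in simp)
  show ?thesis
  proof
    show "{0..\<tau>} \<subseteq> G" using before \<tau>G by (force simp: less_le)
    fix e :: real assume e: "0 < e"
    obtain s where s: "s \<in> B" "s < \<tau> + e"
      using cInf_lessD[OF ne, of "\<tau> + e"] e by (auto simp: \<tau>_def)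
    have "\<tau> \<le> s" unfolding \<tau>_def by (rule cInf_lower[OF s(1) bd])
    moreover have "s \<noteq> \<tau>" "s \<notin> G" using s \<tau>G by (auto simp: B_def)
    ultimately show "\<exists>s. \<tau> < s \<and> s < \<tau> + e \<and> s \<notin> G" using s(2) by (intro exI[of _ s]) auto
  qed (use \<tau>0 \<tau>b in auto)
qed

text \<open>
  Quantitative rotation of the Lienard flow in the half-plane \<open>x \<ge> 0\<close>, in the coordinates
  \<open>(u x, y)\<close> with a rescaled abscissa \<open>u\<close>: beyond radius \<open>R\<close> the angle decreases
  at least at the rate \<open>c u' x\<close> (assumption \<open>turning\<close>), and everywhere the
  logarithm of the radius changes at most at the rate \<open>C u' x\<close> (assumption \<open>growth\<close>). All
  conditions are invariant under \<open>f \<mapsto> - f\<close>, so they serve for both directions of time.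
\<close>

locale right_rotation =
  fixes u u' g f :: "real \<Rightarrow> real" and R c C :: real
  assumes deriv_u: "(u has_real_derivative u' x) (at x)"
    and u_0: "u 0 = 0"
    and u_ge: "0 \<le> x \<Longrightarrow> x \<le> u x"
    and u'_ge: "0 \<le> x \<Longrightarrow> 1 \<le> u' x"
    and R_pos: "0 < R" and c_pos: "0 < c"
    and turning: "0 \<le> x \<Longrightarrow> R\<^sup>2 \<le> (u x)\<^sup>2 + y\<^sup>2 \<Longrightarrow>
      c * u' x * ((u x)\<^sup>2 + y\<^sup>2) \<le> u' x * y\<^sup>2 + f x * u x * y + g x * u x"
    and growth: "0 \<le> x \<Longrightarrow> \<bar>u x * u' x * y - g x * y - f x * y\<^sup>2\<bar> \<le> C * u' x * ((u x)\<^sup>2 + y\<^sup>2)"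
begin

text \<open>
  The radius in the coordinates \<open>(u, y)\<close>. It is meant for points with nonnegative abscissa.
\<close>

definition radius :: "real \<times> real \<Rightarrow> real" where
  "radius p = sqrt ((u (fst p))\<^sup>2 + (snd p)\<^sup>2)"

text \<open>
  During half a turn the radius changes by a factor of at most \<open>exp (C / c * pi)\<close>. The additional
  factor \<open>exp 1\<close> makes this bound strict.
\<close>

definition M :: real where
  "M = exp (C / c * pi + 1)"

lemma C_nonneg: "0 \<le> C"
proof -
  have "0 \<le> C * u' 0 * ((u 0)\<^sup>2 + 1\<^sup>2)" using growth[of 0 1] abs_ge_zero order_trans by blast
  then show ?thesis using u'_ge[of 0] u_0 by (auto simp: zero_le_mult_iff)
qed

lemma M_gt_1: "1 < M"
  unfolding M_def using C_nonneg c_pos by (simp add: add_nonneg_pos)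

lemma right_rotation_neg: "right_rotation u u' g (\<lambda>x. - f x) R c C"
proof
  show "c * u' x * ((u x)\<^sup>2 + y\<^sup>2) \<le> u' x * y\<^sup>2 + - f x * u x * y + g x * u x"
    if "0 \<le> x" "R\<^sup>2 \<le> (u x)\<^sup>2 + y\<^sup>2" for x y
    using turning[of x "- y"] that by simp
  show "\<bar>u x * u' x * y - g x * y - - f x * y\<^sup>2\<bar> \<le> C * u' x * ((u x)\<^sup>2 + y\<^sup>2)"
    if "0 \<le> x" for x y
    using growth[of x "- y"] that by (simp add: abs_if split: if_splits)
qed (use deriv_u u_0 u_ge u'_ge R_pos c_pos in auto)

lemma norm_le_radius:
  assumes "0 \<le> fst p" shows "norm p \<le> radius p"
proof -
  have "(fst p)\<^sup>2 \<le> (u (fst p))\<^sup>2" using assms u_ge by (intro power_mono) auto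
  then show ?thesis by (cases p) (simp add: norm_prod_def radius_def)
qed

text \<open>
  The equation is required only at times when \<open>\<gamma>\<close> is in the right half-plane and within radius
  \<open>M * radius p\<close>. Hence the lemma also applies to solutions of a system that has been
  modified far away.
\<close>

lemma forward_half_turn:
  assumes p: "0 \<le> fst p" "M * R \<le> radius p" and \<gamma>0: "\<gamma> 0 = p"
    and cont: "continuous_on UNIV \<gamma>"
    and \<gamma>: "\<And>t. 0 \<le> fst (\<gamma> t) \<Longrightarrow> radius (\<gamma> t) \<le> M * radius p \<Longrightarrow>
        (\<gamma> has_vector_derivative lienard g f (\<gamma> t)) (at t)"
  obtains \<tau> where "0 \<le> \<tau>" "fst (\<gamma> \<tau>) = 0" "snd (\<gamma> \<tau>) < 0"
    "\<And>s. 0 \<le> s \<Longrightarrow> s \<le> \<tau> \<Longrightarrow> 0 \<le> fst (\<gamma> s) \<and> radius p / M \<le> radius (\<gamma> s) \<and> radius (\<gamma> s) \<le> M * radius p"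
    "\<And>s t. 0 \<le> s \<Longrightarrow> s < t \<Longrightarrow> t \<le> \<tau> \<Longrightarrow> snd (\<gamma> s) \<le> 0 \<Longrightarrow> snd (\<gamma> t) < 0"
proof -
  define x where "x t = fst (\<gamma> t)" for t
  define y where "y t = snd (\<gamma> t)" for t
  \<comment> \<open>The complex logarithm of \<open>u + i y\<close> has \<open>ln r\<close> as real part and the angle as imaginary part, and it is smooth on \<open>x \<ge> 0\<close> away from the origin.\<close>
  define z where "z t = Complex (u (x t)) (y t)" for t
  define G where "G = {t. 0 \<le> x t \<and> radius p / M \<le> radius (\<gamma> t) \<and> radius (\<gamma> t) \<le> M * radius p}"
  define \<theta> where "\<theta> t = Im (Ln (z t))" for t
  define \<rho> where "\<rho> t = Re (Ln (z t))" for t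
  have M0: "0 < M" using M_gt_1 by simp
  have r0: "0 < radius p" using p(2) R_pos M0 by (smt (verit) mult_pos_pos)
  have cm: "cmod (z t) = radius (\<gamma> t)" for t by (simp add: z_def radius_def x_def y_def cmod_def)
  have r2: "(radius (\<gamma> t))\<^sup>2 = (u (x t))\<^sup>2 + (y t)\<^sup>2" for t by (simp add: radius_def x_def y_def)
  have far: "R\<^sup>2 \<le> (u (x t))\<^sup>2 + (y t)\<^sup>2" and rpos: "0 < radius (\<gamma> t)" if "t \<in> G" for t
  proof -
    have "R \<le> radius p / M" using p(2) M0 by (simp add: field_simps)
    also have "\<dots> \<le> radius (\<gamma> t)" using that by (simp add: G_def)
    finally have "R \<le> radius (\<gamma> t)" .
    then show "R\<^sup>2 \<le> (u (x t))\<^sup>2 + (y t)\<^sup>2" "0 < radius (\<gamma> t)" 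
      using R_pos power_mono[of R "radius (\<gamma> t)" 2] by (simp_all add: r2)
  qed
  have upos: "0 \<le> u (x t)" if "t \<in> G" for t
    using that u_ge[of "x t"] by (auto simp: G_def)
  have z0: "z t \<noteq> 0" if "t \<in> G" for t using rpos[OF that] cm[of t] by auto
  have zslit: "z t \<notin> \<real>\<^sub>\<le>\<^sub>0" if "t \<in> G" for t
    using z0[OF that] upos[OF that] by (auto simp: complex_nonpos_Reals_iff z_def complex_eq_iff)
  have \<theta>b: "\<bar>\<theta> t\<bar> \<le> pi / 2" if "t \<in> G" for t
    unfolding \<theta>_def using Re_Ln_pos_le[OF z0[OF that]] upos[OF that] by (simp add: z_def)
  have d: "(\<gamma> has_vector_derivative lienard g f (\<gamma> t)) (at t)" if "t \<in> G" for t
    using that \<gamma>[of t] by (simp add: G_def x_def)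
  have dx: "(x has_real_derivative y t) (at t)" if "t \<in> G" for t
    unfolding x_def y_def by (rule lienard_solution_components[OF d[OF that]])
  have dy: "(y has_real_derivative - g (x t) - f (x t) * y t) (at t)" if "t \<in> G" for t
    unfolding x_def y_def by (rule lienard_solution_components[OF d[OF that]])
  define Q where "Q t = u' (x t) * (y t)\<^sup>2 + f (x t) * u (x t) * y t + g (x t) * u (x t)" for t
  define P where "P t = u (x t) * u' (x t) * y t - g (x t) * y t - f (x t) * (y t)\<^sup>2" for t
  have dLn: "((\<lambda>t. Ln (z t)) has_vector_derivative
      Complex (u' (x t) * y t) (- g (x t) - f (x t) * y t) * inverse (z t)) (at t)" if "t \<in> G" for t
  proof -
    have 1: "((\<lambda>t. u (x t)) has_real_derivative u' (x t) * y t) (at t)"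
      by (rule DERIV_chain2[OF deriv_u dx[OF that]])
    have "(z has_vector_derivative Complex (u' (x t) * y t) (- g (x t) - f (x t) * y t)) (at t)"
      unfolding z_def has_vector_derivative_complex_iff using 1 dy[OF that]
      by simp
    from field_vector_diff_chain_at[OF this has_field_derivative_Ln[OF zslit[OF that]]]
    show ?thesis by (simp add: o_def)
  qed
  have quot: "a * inverse (z t) = a * cnj (z t) / of_real ((radius (\<gamma> t))\<^sup>2)" if "t \<in> G" for t a
  proof -
    have "of_real ((radius (\<gamma> t))\<^sup>2) = z t * cnj (z t)"
      unfolding cm[symmetric] by (rule complex_norm_square)
    then show ?thesis using z0[OF that] by (simp add: field_simps)
  qed
  have d\<theta>: "(\<theta> has_real_derivative - Q t / (radius (\<gamma> t))\<^sup>2) (at t)" if "t \<in> G" for t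
  proof -
    have "(\<theta> has_real_derivative
        Im (Complex (u' (x t) * y t) (- g (x t) - f (x t) * y t) * inverse (z t))) (at t)"
      unfolding \<theta>_def has_real_derivative_iff_has_vector_derivative
      by (rule bounded_linear.has_vector_derivative[OF bounded_linear_Im dLn[OF that]])
    moreover have "Im (Complex (u' (x t) * y t) (- g (x t) - f (x t) * y t) * cnj (z t)) = - Q t"
      by (simp add: z_def Q_def algebra_simps power2_eq_square)
    ultimately show ?thesis by (simp only: quot[OF that] Im_divide_of_real)
  qed
  have d\<rho>: "(\<rho> has_real_derivative P t / (radius (\<gamma> t))\<^sup>2) (at t)" if "t \<in> G" for t
  proof -
    have "(\<rho> has_real_derivative
        Re (Complex (u' (x t) * y t) (- g (x t) - f (x t) * y t) * inverse (z t))) (at t)"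
      unfolding \<rho>_def has_real_derivative_iff_has_vector_derivative
      by (rule bounded_linear.has_vector_derivative[OF bounded_linear_Re dLn[OF that]])
    moreover have "Re (Complex (u' (x t) * y t) (- g (x t) - f (x t) * y t) * cnj (z t)) = P t"
      by (simp add: z_def P_def algebra_simps power2_eq_square)
    ultimately show ?thesis by (simp only: quot[OF that] Re_divide_of_real)
  qed
  have Qr: "c * u' (x t) \<le> Q t / (radius (\<gamma> t))\<^sup>2" "c \<le> c * u' (x t)"
    and Pr: "\<bar>P t / (radius (\<gamma> t))\<^sup>2\<bar> \<le> C * u' (x t)" if "t \<in> G" for t
  proof -
    have x0: "0 \<le> x t" using that by (simp add: G_def)
    have rr: "0 < (radius (\<gamma> t))\<^sup>2" using rpos[OF that] by simp
    show "c * u' (x t) \<le> Q t / (radius (\<gamma> t))\<^sup>2"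
      using turning[OF x0 far[OF that]] rr unfolding r2[symmetric] Q_def by (simp add: le_divide_eq)
    show "\<bar>P t / (radius (\<gamma> t))\<^sup>2\<bar> \<le> C * u' (x t)"
      using growth[OF x0, of "y t"] rr unfolding r2[symmetric] P_def by (simp add: abs_divide divide_le_eq)
    show "c \<le> c * u' (x t)" using u'_ge[OF x0] c_pos by simp
  qed
  have decr: "\<theta> t \<le> \<theta> s - c * (t - s)" if "s \<le> t" "{s..t} \<subseteq> G" for s t
  proof -
    have "\<theta> t + c * t \<le> \<theta> s + c * s"
    proof (rule DERIV_nonpos_imp_nonincreasing[OF that(1), of "\<lambda>t. \<theta> t + c * t"])
      fix r assume "s \<le> r" "r \<le> t"
      then have r: "r \<in> G" using that by auto
      have "((\<lambda>t. \<theta> t + c * t) has_real_derivative - Q r / (radius (\<gamma> r))\<^sup>2 + c) (at r)"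
        by (auto intro!: derivative_eq_intros d\<theta>[OF r])
      moreover have "- Q r / (radius (\<gamma> r))\<^sup>2 + c \<le> 0" using Qr[OF r] by simp
      ultimately show "\<exists>y. ((\<lambda>t. \<theta> t + c * t) has_real_derivative y) (at r) \<and> y \<le> 0" by blast
    qed
    then show ?thesis by (simp add: algebra_simps)
  qed
  have lograd: "\<bar>\<rho> t - \<rho> 0\<bar> \<le> C / c * pi" if "0 \<le> t" "{0..t} \<subseteq> G" for t
  proof -
    define K where "K = C / c"
    have K: "0 \<le> K" "K * c = C" using C_nonneg c_pos by (auto simp: K_def)
    have Kb: "\<bar>P r / (radius (\<gamma> r))\<^sup>2\<bar> \<le> K * (Q r / (radius (\<gamma> r))\<^sup>2)" if r: "r \<in> G" for r
    proof -
      have "C * u' (x r) = K * (c * u' (x r))" using K by simp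
      also have "\<dots> \<le> K * (Q r / (radius (\<gamma> r))\<^sup>2)" using Qr[OF r] K by (intro mult_left_mono) auto
      finally show ?thesis using Pr[OF r] by linarith
    qed
    have "\<rho> t + K * \<theta> t \<le> \<rho> 0 + K * \<theta> 0"
    proof (rule DERIV_nonpos_imp_nonincreasing[OF that(1), of "\<lambda>t. \<rho> t + K * \<theta> t"])
      fix r assume "0 \<le> r" "r \<le> t"
      then have r: "r \<in> G" using that by auto
      have "((\<lambda>t. \<rho> t + K * \<theta> t) has_real_derivative P r / (radius (\<gamma> r))\<^sup>2 + K * (- Q r / (radius (\<gamma> r))\<^sup>2)) (at r)"
        by (intro derivative_intros d\<theta>[OF r] d\<rho>[OF r] DERIV_cmult)
      moreover have "P r / (radius (\<gamma> r))\<^sup>2 + K * (- Q r / (radius (\<gamma> r))\<^sup>2) \<le> 0" using abs_le_D1[OF Kb[OF r]] by simp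
      ultimately show "\<exists>y. ((\<lambda>t. \<rho> t + K * \<theta> t) has_real_derivative y) (at r) \<and> y \<le> 0" by blast
    qed
    moreover have "\<rho> 0 - K * \<theta> 0 \<le> \<rho> t - K * \<theta> t"
    proof (rule DERIV_nonneg_imp_nondecreasing[OF that(1), of "\<lambda>t. \<rho> t - K * \<theta> t"])
      fix r assume "0 \<le> r" "r \<le> t"
      then have r: "r \<in> G" using that by auto
      have "((\<lambda>t. \<rho> t - K * \<theta> t) has_real_derivative P r / (radius (\<gamma> r))\<^sup>2 - K * (- Q r / (radius (\<gamma> r))\<^sup>2)) (at r)"
        by (intro derivative_intros d\<theta>[OF r] d\<rho>[OF r] DERIV_cmult)
      moreover have "P r / (radius (\<gamma> r))\<^sup>2 - K * (- Q r / (radius (\<gamma> r))\<^sup>2) \<ge> 0" using abs_le_D2[OF Kb[OF r]] by simp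
      ultimately show "\<exists>y. ((\<lambda>t. \<rho> t - K * \<theta> t) has_real_derivative y) (at r) \<and> 0 \<le> y" by blast
    qed
    ultimately have "\<bar>\<rho> t - \<rho> 0\<bar> \<le> K * (\<theta> 0 - \<theta> t)" by (simp add: algebra_simps abs_le_iff)
    also have "\<theta> 0 - \<theta> t \<le> pi"
      using \<theta>b[of 0] \<theta>b[of t] that by (simp add: subset_iff abs_le_iff)
    then have "K * (\<theta> 0 - \<theta> t) \<le> K * pi" using K by (intro mult_left_mono)
    finally show ?thesis by (simp add: K_def)
  qed
  \<comment> \<open>As long as the orbit stays in \<open>G\<close>, it stays away from the bounds for the radius in the definition of \<open>G\<close>, so it can leave \<open>G\<close> only through the \<open>y\<close>-axis.\<close>
  have strict: "radius p / M < radius (\<gamma> t)" "radius (\<gamma> t) < M * radius p"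
    if "0 \<le> t" "{0..t} \<subseteq> G" for t
  proof -
    have tG: "t \<in> G" "0 \<in> G" using that by auto
    have \<rho>: "\<rho> t = ln (radius (\<gamma> t))" "\<rho> 0 = ln (radius p)"
      using z0[OF tG(1)] z0[OF tG(2)] cm[of t] cm[of 0] \<gamma>0 by (simp_all add: \<rho>_def)
    have "ln M = C / c * pi + 1" by (simp add: M_def)
    then have "ln (radius (\<gamma> t)) < ln M + ln (radius p)" "ln (radius p) - ln M < ln (radius (\<gamma> t))"
      using lograd[OF that] unfolding \<rho> by (simp_all add: abs_le_iff)
    then have "ln (radius (\<gamma> t)) < ln (M * radius p)" "ln (radius p / M) < ln (radius (\<gamma> t))"
      using M0 r0 by (simp_all add: ln_mult ln_div)
    then show "radius p / M < radius (\<gamma> t)" "radius (\<gamma> t) < M * radius p"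
      using M0 r0 rpos[OF tG(1)] by (simp_all add: ln_less_cancel_iff)
  qed
  have G0: "0 \<in> G"
    using p r0 M_gt_1 \<gamma>0 by (auto simp: G_def x_def divide_le_eq)
  have uc: "continuous_on UNIV u"
    using deriv_u by (intro continuous_at_imp_continuous_on) (auto intro: DERIV_isCont)
  have xc: "continuous_on UNIV x" and yc: "continuous_on UNIV y"
    unfolding x_def y_def by (intro continuous_intros cont)+
  have rc: "continuous_on UNIV (\<lambda>t. radius (\<gamma> t))"
    unfolding radius_def x_def[symmetric] y_def[symmetric]
    by (intro continuous_intros continuous_on_compose2[OF uc xc] yc) auto
  have clG: "closed G"
    unfolding G_def by (intro closed_Collect_conj closed_Collect_le xc rc continuous_intros)
  \<comment> \<open>The angle decreases at least at the rate \<open>c\<close> but varies by at most \<open>pi\<close> on \<open>G\<close>.\<close>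
  have "\<exists>b\<ge>0. b \<notin> G"
  proof (rule ccontr)
    assume "\<not> (\<exists>b\<ge>0. b \<notin> G)"
    then have all: "{0..t} \<subseteq> G" for t by auto
    have "\<theta> (2 * pi / c) \<le> \<theta> 0 - 2 * pi"
      using decr[of 0 "2 * pi / c"] all c_pos by simp
    moreover have "2 * pi / c \<in> G" using c_pos all[of "2 * pi / c"] by auto
    then have "\<bar>\<theta> (2 * pi / c)\<bar> \<le> pi / 2" "\<bar>\<theta> 0\<bar> \<le> pi / 2"
      using \<theta>b[of "2 * pi / c"] \<theta>b[OF G0] by blast+
    ultimately show False using pi_gt_zero by linarith
  qed
  then obtain \<tau> where \<tau>: "0 \<le> \<tau>" "{0..\<tau>} \<subseteq> G"
    and exit: "\<And>e. 0 < e \<Longrightarrow> \<exists>s. \<tau> < s \<and> s < \<tau> + e \<and> s \<notin> G"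
    using first_exit_time[OF clG G0] by metis
  have \<tau>G: "\<tau> \<in> G" using \<tau> by auto
  have "\<forall>\<^sub>F s in at \<tau>. radius p / M < radius (\<gamma> s)" "\<forall>\<^sub>F s in at \<tau>. radius (\<gamma> s) < M * radius p"
    using rc strict[OF \<tau>] by (auto simp: continuous_on_def intro: order_tendstoD)
  then have "\<forall>\<^sub>F s in at \<tau>. radius p / M < radius (\<gamma> s) \<and> radius (\<gamma> s) < M * radius p"
    by (rule eventually_conj)
  then obtain e where e: "0 < e" and near: "\<And>s. s \<noteq> \<tau> \<Longrightarrow> dist s \<tau> < e \<Longrightarrow>
      radius p / M < radius (\<gamma> s) \<and> radius (\<gamma> s) < M * radius p"
    unfolding eventually_at by auto
  have neg: "\<exists>s. \<tau> < s \<and> s < \<tau> + h \<and> x s < 0" if h: "0 < h" for h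
  proof -
    obtain s where s: "\<tau> < s" "s < \<tau> + min h e" "s \<notin> G" using exit[of "min h e"] h e by auto
    then have "radius p / M < radius (\<gamma> s) \<and> radius (\<gamma> s) < M * radius p"
      by (intro near) (auto simp: dist_real_def)
    then have "x s < 0" using s(3) by (auto simp: G_def)
    then show ?thesis using s by auto
  qed
  have x\<tau>: "x \<tau> = 0"
  proof (rule ccontr)
    assume "x \<tau> \<noteq> 0"
    then have "0 < x \<tau>" using \<tau>G by (simp add: G_def)
    then have "\<forall>\<^sub>F s in at \<tau>. 0 < x s" using xc by (auto simp: continuous_on_def intro: order_tendstoD)
    then obtain h where "0 < h" "\<And>s. s \<noteq> \<tau> \<Longrightarrow> dist s \<tau> < h \<Longrightarrow> 0 < x s"
      unfolding eventually_at by auto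
    then show False using neg[of h] by (force simp: dist_real_def)
  qed
  have y\<tau>: "y \<tau> < 0"
  proof (rule ccontr)
    assume "\<not> y \<tau> < 0"
    moreover have "y \<tau> \<noteq> 0" using z0[OF \<tau>G] x\<tau> u_0 by (auto simp: z_def complex_eq_iff)
    ultimately have "0 < y \<tau>" by simp
    then obtain h where h: "0 < h" "\<And>k. 0 < k \<Longrightarrow> k < h \<Longrightarrow> x \<tau> < x (\<tau> + k)"
      using DERIV_pos_inc_right[OF dx[OF \<tau>G]] by blast
    obtain s where "\<tau> < s" "s < \<tau> + h" "x s < 0" using neg[OF h(1)] by blast
    then show False using h(2)[of "s - \<tau>"] x\<tau> by simp
  qed
  show ?thesis
  proof
    show "0 \<le> \<tau>" by (rule \<tau>)
    show "fst (\<gamma> \<tau>) = 0" "snd (\<gamma> \<tau>) < 0" using x\<tau> y\<tau> by (simp_all add: x_def y_def)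
    show "0 \<le> fst (\<gamma> s) \<and> radius p / M \<le> radius (\<gamma> s) \<and> radius (\<gamma> s) \<le> M * radius p"
      if "0 \<le> s" "s \<le> \<tau>" for s
      using \<tau> that by (auto simp: G_def x_def)
    show "snd (\<gamma> t) < 0" if st: "0 \<le> s" "s < t" "t \<le> \<tau>" "snd (\<gamma> s) \<le> 0" for s t
    proof -
      have G: "{s..t} \<subseteq> G" "s \<in> G" "t \<in> G" using \<tau> st by auto
      have "\<theta> s \<le> 0"
        using Im_Ln_pos_lt[OF z0[OF G(2)]] Im_Ln_eq_0[OF z0[OF G(2)]] st(4) 
          \<theta>b[OF G(2)] pi_gt_zero
        by (auto simp: \<theta>_def z_def y_def)
      then have "\<theta> t < 0" using decr[of s t] G st mult_pos_pos[OF c_pos, of "t - s"] by simp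
      then show ?thesis
        using Im_Ln_pos_le[OF z0[OF G(3)]] \<theta>b[OF G(3)] by (auto simp: \<theta>_def z_def y_def)
    qed
  qed
qed

end

section \<open>Reversible systems\<close>

lemma continuous_derivative_imp_lipschitz_on_interval:
  fixes h :: "real \<Rightarrow> real"
  assumes h: "\<And>x. (h has_real_derivative h' x) (at x)" and h': "continuous_on UNIV h'"
  shows "\<exists>L. L-lipschitz_on {a..b} h"
proof -
  have "compact (h' ` {a..b})"
    using h' by (intro compact_continuous_image) (auto intro: continuous_on_subset)
  then obtain L where L: "0 < L" "\<And>x. x \<in> {a..b} \<Longrightarrow> norm (h' x) \<le> L"
    using compact_imp_bounded bounded_pos by (metis imageI)
  have "L-lipschitz_on {a..b} h"
  proof (rule lipschitz_onI)
    show "dist (h x) (h y) \<le> L * dist x y" if "x \<in> {a..b}" "y \<in> {a..b}" for x y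
      unfolding dist_norm
      using field_differentiable_bound[of "{a..b}" h h' L x y] L(2) h that
      by (auto intro: has_field_derivative_at_within)
  qed (use L in simp)
  then show ?thesis by blast
qed

lemma lienard_lipschitz_on_box:
  assumes "Lg-lipschitz_on {-B..B} g" "Lf-lipschitz_on {-B..B} f" and B: "0 \<le> B"
  shows "\<exists>L. L-lipschitz_on ({-B..B} \<times> {-B..B}) (lienard g f)"
proof -
  have Lf: "0 \<le> Lf" and Lg: "0 \<le> Lg" using assms lipschitz_on_nonneg by blast+
  define F where "F = \<bar>f 0\<bar> + Lf * B"
  have fb: "\<bar>f x\<bar> \<le> F" if "x \<in> {-B..B}" for x
  proof -
    have "\<bar>f x - f 0\<bar> \<le> Lf * \<bar>x - 0\<bar>"
      using lipschitz_on_normD[OF assms(2) that, of 0] B by simp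
    also have "\<dots> \<le> Lf * B" using that Lf by (intro mult_left_mono) auto
    finally show ?thesis by (simp add: F_def)
  qed
  have F: "0 \<le> F" using Lf B by (simp add: F_def)
  have "(Lg + Lf * B + F)-lipschitz_on ({-B..B} \<times> {-B..B}) (\<lambda>p. - g (fst p) - f (fst p) * snd p)"
  proof (rule lipschitz_onI)
    fix p q assume pq: "p \<in> {-B..B} \<times> {-B..B}" "q \<in> {-B..B} \<times> {-B..B}"
    obtain x y where p: "p = (x, y)" by (cases p)
    obtain x' y' where q: "q = (x', y')" by (cases q)
    have d1: "\<bar>x - x'\<bar> \<le> dist p q" and d2: "\<bar>y - y'\<bar> \<le> dist p q"
      using dist_fst_le[of p q] dist_snd_le[of p q] by (simp_all add: p q dist_real_def)
    have "\<bar>g x - g x'\<bar> \<le> Lg * \<bar>x - x'\<bar>" "\<bar>f x - f x'\<bar> \<le> Lf * \<bar>x - x'\<bar>"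
      using lipschitz_on_normD[OF assms(1), of x x'] lipschitz_on_normD[OF assms(2), of x x'] pq
      by (auto simp: p q)
    then have g: "\<bar>g x - g x'\<bar> \<le> Lg * dist p q" and f: "\<bar>f x - f x'\<bar> \<le> Lf * dist p q"
      using mult_left_mono[OF d1 Lg] mult_left_mono[OF d1 Lf] by linarith+
    have "\<bar>(f x - f x') * y\<bar> \<le> (Lf * dist p q) * B"
      unfolding abs_mult using f pq by (intro mult_mono) (auto simp: p q Lf)
    moreover have "\<bar>f x' * (y - y')\<bar> \<le> F * dist p q"
      unfolding abs_mult using fb[of x'] d2 pq F by (intro mult_mono) (auto simp: p q)
    moreover have "(- g x - f x * y) - (- g x' - f x' * y') = - (g x - g x') - (f x - f x') * y - f x' * (y - y')"
      by (simp add: algebra_simps)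
    ultimately have "\<bar>(- g x - f x * y) - (- g x' - f x' * y')\<bar> \<le> Lg * dist p q + (Lf * dist p q) * B + F * dist p q"
      using g by linarith
    then show "dist (- g (fst p) - f (fst p) * snd p) (- g (fst q) - f (fst q) * snd q) \<le> (Lg + Lf * B + F) * dist p q"
      by (simp add: p q dist_real_def algebra_simps)
  qed (use Lf Lg B F in simp)
  moreover have "1-lipschitz_on ({-B..B} \<times> {-B..B}) (snd :: real \<times> real \<Rightarrow> real)"
    by (rule lipschitz_onI) (auto intro: dist_snd_le)
  ultimately have "\<exists>L. L-lipschitz_on ({-B..B} \<times> {-B..B}) (\<lambda>p. (snd p, - g (fst p) - f (fst p) * snd p))"
    using lipschitz_on_Pair by blast
  then show ?thesis by (simp add: lienard_def case_prod_beta')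
qed

text \<open>
  The retraction of the plane onto the square of half-width \<open>B\<close>. Composed with it, a Lienard system
  becomes bounded and globally Lipschitz; the symmetry under \<open>mirror\<close> is preserved.
\<close>

definition truncate :: "real \<Rightarrow> real \<times> real \<Rightarrow> real \<times> real" where
  "truncate B p = (max (- B) (min B (fst p)), max (- B) (min B (snd p)))"

lemma truncate_in_box: "0 \<le> B \<Longrightarrow> truncate B p \<in> {-B..B} \<times> {-B..B}"
  by (auto simp: truncate_def)

lemma truncate_mirror: "0 \<le> B \<Longrightarrow> truncate B (mirror p) = mirror (truncate B p)"
  by (cases p) (auto simp: truncate_def max_def min_def)

lemma truncate_id: "norm p \<le> B \<Longrightarrow> truncate B p = p"
proof -
  assume "norm p \<le> B"
  then have "\<bar>fst p\<bar> \<le> B" "\<bar>snd p\<bar> \<le> B"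
    using norm_fst_le[of "fst p" "snd p"] norm_snd_le[of "snd p" "fst p"] by auto
  then show ?thesis by (cases p) (auto simp: truncate_def)
qed

lemma truncate_lipschitz: "1-lipschitz_on UNIV (truncate B)"
proof (rule lipschitz_onI)
  fix p q :: "real \<times> real"
  have *: "\<bar>max (- B) (min B s) - max (- B) (min B t)\<bar> \<le> \<bar>s - t\<bar>" for s t :: real
    by (auto simp: max_def min_def)
  have "dist (truncate B p) (truncate B q) \<le> dist p q"
    unfolding dist_prod_def truncate_def dist_real_def fst_conv snd_conv
    by (intro real_sqrt_le_mono add_mono power_mono *) auto
  then show "dist (truncate B p) (truncate B q) \<le> 1 * dist p q" by simp
qed simp

context right_rotation
begin

lemma closed_orbit_through_far_point:
  assumes odd: "odd_fun g" "odd_fun f"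
    and lip: "\<And>B. 0 \<le> B \<Longrightarrow> \<exists>L. L-lipschitz_on ({-B..B} \<times> {-B..B}) (lienard g f)"
    and p: "0 \<le> fst p" "M * R \<le> norm p"
  shows "\<exists>C. closed_orbit (lienard g f) C \<and> p \<in> C"
proof -
  interpret neg: right_rotation u u' g "\<lambda>x. - f x" R c C by (rule right_rotation_neg)
  have rp: "M * R \<le> radius p" using p norm_le_radius[OF p(1)] by simp
  define B where "B = M * radius p"
  have "0 < M * R" using M_gt_1 R_pos by simp
  then have B: "0 \<le> B" using M_gt_1 rp by (simp add: B_def)
  obtain L where L: "L-lipschitz_on ({-B..B} \<times> {-B..B}) (lienard g f)" using lip[OF B] by blast
  define Y where "Y = (\<lambda>p. lienard g f (truncate B p))"
  have Ylip: "(L * 1)-lipschitz_on UNIV Y"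
    unfolding Y_def
    by (rule lipschitz_on_compose2[OF truncate_lipschitz lipschitz_on_subset[OF L]])
       (use truncate_in_box[OF B] in blast)
  have Ybd: "\<exists>b. \<forall>p. norm (Y p) \<le> b"
  proof -
    have "compact (lienard g f ` ({-B..B} \<times> {-B..B}))"
      by (intro compact_continuous_image lipschitz_on_continuous_on[OF L] compact_Times compact_Icc)
    then obtain b where "\<And>q. q \<in> {-B..B} \<times> {-B..B} \<Longrightarrow> norm (lienard g f q) \<le> b"
      using compact_imp_bounded bounded_iff by (metis imageI)
    then show ?thesis unfolding Y_def using truncate_in_box[OF B] by blast
  qed
  obtain \<gamma> where \<gamma>0: "\<gamma> 0 = p" and \<gamma>: "\<And>t. (\<gamma> has_vector_derivative Y (\<gamma> t)) (at t)"
    using lipschitz_ode_global_solution[OF Ylip] Ybd by blast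
  have Yeq: "Y q = lienard g f q" if "norm q \<le> B" for q
    by (simp add: Y_def truncate_id[OF that])
  have Ymirror: "Y (mirror q) = - mirror (Y q)" for q
    using lienard_mirror[OF odd(1), of f "truncate B q"] odd(2)
    by (simp add: Y_def truncate_mirror[OF B] odd_fun_def)
  have cont: "continuous_on UNIV \<gamma>"
    using \<gamma> by (intro continuous_at_imp_continuous_on) (auto intro: has_vector_derivative_continuous)
  have sol: "(\<gamma> has_vector_derivative lienard g f (\<gamma> t)) (at t)"
    if "0 \<le> fst (\<gamma> t)" "radius (\<gamma> t) \<le> M * radius p" for t
    using \<gamma>[of t] Yeq[of "\<gamma> t"] norm_le_radius[OF that(1)] that(2) by (simp add: B_def)
  obtain b where b: "0 \<le> b" "fst (\<gamma> b) = 0" "snd (\<gamma> b) < 0"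
    and bbd: "\<And>s. 0 \<le> s \<Longrightarrow> s \<le> b \<Longrightarrow> 0 \<le> fst (\<gamma> s) \<and> radius p / M \<le> radius (\<gamma> s) \<and> radius (\<gamma> s) \<le> M * radius p"
    using forward_half_turn[OF p(1) rp \<gamma>0 cont sol] by metis
  define \<delta> where "\<delta> t = flip (\<gamma> (- t))" for t
  have \<delta>0: "\<delta> 0 = flip p" by (simp add: \<delta>_def \<gamma>0)
  have rflip: "radius (flip q) = radius q" for q by (simp add: radius_def)
  have \<delta>cont: "continuous_on UNIV \<delta>"
    unfolding \<delta>_def flip_def by (intro continuous_intros continuous_on_compose2[OF cont]) auto
  have \<delta>sol: "(\<delta> has_vector_derivative lienard g (\<lambda>x. - f x) (\<delta> t)) (at t)"
    if "0 \<le> fst (\<delta> t)" "radius (\<delta> t) \<le> M * radius (flip p)" for t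
  proof -
    have "(\<gamma> has_vector_derivative lienard g f (\<gamma> (- t))) (at (- t))"
      using that sol[of "- t"] by (simp add: \<delta>_def rflip)
    then have "((\<lambda>t. \<gamma> (0 - t)) has_vector_derivative - lienard g f (\<gamma> (- t))) (at t)"
      by (intro has_vector_derivative_reflect) simp
    from bounded_linear.has_vector_derivative[OF bounded_linear_flip this]
    show ?thesis
      unfolding \<delta>_def lienard_flip by (simp add: linear_neg[OF bounded_linear.linear[OF bounded_linear_flip]])
  qed
  have fp: "0 \<le> fst (flip p)" "M * R \<le> radius (flip p)" using p(1) rp by (simp_all add: rflip)
  obtain a' where a': "0 \<le> a'" "fst (\<delta> a') = 0" "snd (\<delta> a') < 0"
    and abd': "\<And>s. 0 \<le> s \<Longrightarrow> s \<le> a' \<Longrightarrow> 0 \<le> fst (\<delta> s) \<and> radius (flip p) / M \<le> radius (\<delta> s) \<and> radius (\<delta> s) \<le> M * radius (flip p)"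
    using neg.forward_half_turn[OF fp \<delta>0 \<delta>cont \<delta>sol] by metis
  define a where "a = - a'"
  have a: "a \<le> 0" "fst (\<gamma> a) = 0" "0 < snd (\<gamma> a)" using a' by (simp_all add: a_def \<delta>_def)
  have bound: "norm (\<gamma> s) \<le> B" if "a \<le> s" "s \<le> b" for s
  proof -
    have "0 \<le> fst (\<gamma> s) \<and> radius (\<gamma> s) \<le> B"
    proof (cases "0 \<le> s")
      case True then show ?thesis using bbd that by (simp add: B_def)
    next
      case False then show ?thesis using abd'[of "- s"] that by (simp add: B_def a_def \<delta>_def rflip)
    qed
    then show ?thesis using norm_le_radius[of "\<gamma> s"] by simp
  qed
  have ab: "a < b" using a b by (metis antisym_conv1 less_asym order_trans)
  \<comment> \<open>By reversibility and uniqueness, an orbit that meets the \<open>y\<close>-axis at time \<open>d\<close> is symmetric about that time.\<close>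
  have reflect: "\<gamma> (2 * d - t) = mirror (\<gamma> t)" if d: "fst (\<gamma> d) = 0" for d t
  proof -
    have 1: "((\<lambda>t. mirror (\<gamma> (2 * d - t))) has_vector_derivative Y (mirror (\<gamma> (2 * d - t)))) (at t)" for t
      using bounded_linear.has_vector_derivative[OF bounded_linear_mirror has_vector_derivative_reflect[OF \<gamma>[of "2 * d - t"]]]
      by (simp add: Ymirror linear_neg[OF bounded_linear.linear[OF bounded_linear_mirror]])
    have 2: "mirror (\<gamma> (2 * d - d)) = \<gamma> d" using d by (simp add: mirror_def prod_eq_iff)
    have "mirror (\<gamma> (2 * d - t)) = \<gamma> t"
      using lipschitz_ode_unique[OF Ylip 1 \<gamma> 2] .
    then show ?thesis by (metis mirror_simps(2))
  qed
  \<comment> \<open>Two reflections of time, about \<open>a\<close> and about \<open>b\<close>, compose to a translation by the period.\<close>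
  define P where "P = 2 * (b - a)"
  have P: "0 < P" using ab by (simp add: P_def)
  have per: "\<gamma> (t + P) = \<gamma> t" for t
  proof -
    have "\<gamma> (t + P) = \<gamma> (2 * b - (2 * a - t))" by (simp add: P_def algebra_simps)
    then show ?thesis by (simp add: reflect[OF b(2)] reflect[OF a(2)])
  qed
  have bound_period: "norm (\<gamma> s) \<le> B" if "a \<le> s" "s \<le> a + P" for s
  proof (cases "s \<le> b")
    case False
    then show ?thesis using bound[of "2 * b - s"] that reflect[OF b(2), of s] by (simp add: P_def)
  qed (use bound that in simp)
  have bound_all: "norm (\<gamma> s) \<le> B" for s
    using bound_period periodic_representative[where \<gamma>=\<gamma> and a=a and t=s, OF P per] by (metis less_imp_le)
  have "closed_orbit (lienard g f) (range \<gamma>)"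
    unfolding closed_orbit_def
  proof (intro exI conjI allI)
    show "(\<gamma> has_vector_derivative lienard g f (\<gamma> t)) (at t)" for t
      using \<gamma>[of t] Yeq[OF bound_all[of t]] by simp
    show "\<not> \<gamma> constant_on UNIV"
      using a(3) b(3) unfolding constant_on_def by (metis UNIV_I less_asym)
  qed (use P per in auto)
  then show ?thesis using \<gamma>0 by blast
qed

lemma reversible_center_at_infinity:
  assumes odd: "odd_fun g" "odd_fun f"
    and lip: "\<And>B. 0 \<le> B \<Longrightarrow> \<exists>L. L-lipschitz_on ({-B..B} \<times> {-B..B}) (lienard g f)"
  shows "center_at_infinity (lienard g f)"
proof -
  have "\<exists>C. closed_orbit (lienard g f) C \<and> p \<in> C" if p: "M * R \<le> norm p" for p
  proof (cases "0 \<le> fst p")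
    case True
    then show ?thesis using closed_orbit_through_far_point[OF odd lip] p by blast
  next
    case False
    then obtain D where D: "closed_orbit (lienard g f) D" "mirror p \<in> D"
      using closed_orbit_through_far_point[OF odd lip, of "mirror p"] p by auto
    have "(\<lambda>x. - f (- x)) = f" using odd(2) by (simp add: odd_fun_def fun_eq_iff)
    then have "closed_orbit (lienard g f) (mirror ` D)"
      using closed_orbit_time_reversal[where Y="lienard g f", OF D(1) bounded_linear_mirror inj_mirror]
        lienard_mirror[OF odd(1), of f] by simp
    moreover have "p \<in> mirror ` D" by (rule image_eqI[OF _ D(2)]) simp
    ultimately show ?thesis by blast
  qed
  then show ?thesis unfolding center_at_infinity_iff by blast
qed

end

section \<open>Half turns under different damping\<close>

lemma positive_nondecreasing_where_positive:
  fixes e :: "real \<Rightarrow> real"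
  assumes ab: "a \<le> b" and cont: "continuous_on {a..b} e" and ea: "0 < e a"
    and deriv: "\<And>x. a < x \<Longrightarrow> x < b \<Longrightarrow> (e has_real_derivative e' x) (at x)"
    and nonneg: "\<And>x. a < x \<Longrightarrow> x < b \<Longrightarrow> 0 < e x \<Longrightarrow> 0 \<le> e' x"
  shows "e a \<le> e b"
proof (rule ccontr)
  assume less: "\<not> e a \<le> e b"
  define S where "S = {x \<in> {a..b}. e a \<le> e x}"
  have "closed S" unfolding S_def
    by (intro continuous_closed_preimage[of "{a..b}" e "{e a..}", unfolded vimage_def Collect_mem_eq]
        continuous_on_closed_Collect_le continuous_intros cont)
  then have "compact S" unfolding S_def by (auto simp: compact_eq_bounded_closed intro: bounded_subset[OF bounded_closed_interval[of a b]])
  moreover have "a \<in> S" using ab by (simp add: S_def)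
  ultimately obtain s where s: "s \<in> S" and last: "\<And>x. x \<in> S \<Longrightarrow> x \<le> s"
    using compact_attains_sup[of S] by blast
  have sb: "a \<le> s" "s < b" using s less by (auto simp: S_def less_le)
  have cs: "continuous (at s within {a..b}) e"
    using cont s by (auto simp: continuous_on_eq_continuous_within S_def)
  have "0 < e s" using s ea by (auto simp: S_def)
  then have "\<forall>\<^sub>F x in at s within {a..b}. 0 < e x"
    using cs by (auto simp: continuous_within intro: order_tendstoD)
  then obtain d where d: "0 < d" "\<And>x. x \<in> {a..b} \<Longrightarrow> x \<noteq> s \<Longrightarrow> dist x s < d \<Longrightarrow> 0 < e x"
    unfolding eventually_at by auto
  define r where "r = s + min d (b - s) / 2"
  have r: "s < r" "r < s + d" "r < b" using d sb by (auto simp: r_def min_def field_simps)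
  have "e s \<le> e r"
  proof (rule DERIV_nonneg_imp_increasing_open[where f=e])
    fix x assume x: "s < x" "x < r"
    have "0 < e x" using d(2)[of x] x r sb by (auto simp: dist_real_def)
    then have "0 \<le> e' x" using nonneg[of x] x r sb by auto
    moreover have "(e has_real_derivative e' x) (at x)" using deriv[of x] x r sb by auto
    ultimately show "\<exists>y. (e has_real_derivative y) (at x) \<and> 0 \<le> y" by blast
  qed (use r sb cont in \<open>auto intro: continuous_on_subset\<close>)
  then have "r \<in> S" using s r sb by (auto simp: S_def)
  then show False using last[of r] r by simp
qed

text \<open>
  The part of a half turn above the \<open>x\<close>-axis, as the graph of a function \<open>Y\<close> on \<open>[0, l]\<close>; \<open>l\<close> is the
  abscissa of the turning point. After a flip, the part below the axis is a branch for \<open>- f\<close>.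
\<close>

definition branch :: "(real \<Rightarrow> real) \<Rightarrow> (real \<Rightarrow> real) \<Rightarrow> (real \<Rightarrow> real) \<Rightarrow> real \<Rightarrow> bool" where
  "branch g f Y l \<longleftrightarrow> continuous_on {0..l} Y \<and> (\<forall>x. 0 \<le> x \<and> x < l \<longrightarrow> 0 < Y x) \<and> Y l = 0 \<and>
     (\<forall>x. 0 < x \<and> x < l \<longrightarrow> (Y has_real_derivative - g x / Y x - f x) (at x))"

text \<open>
  Over the strip \<open>0 \<le> x \<le> X\<close>, where both branches are at least \<open>\<eta>\<close>, the terms \<open>g / Y\<close> and \<open>g / Z\<close> are
  \<open>O(1 / \<eta>)\<close>, and the difference of the branches changes by about the integral of \<open>f - f2\<close>.
\<close>

lemma strip_estimate:
  fixes Y Z :: "real \<Rightarrow> real"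
  assumes X: "0 < X" and cont: "continuous_on {0..X} Y" "continuous_on {0..X} Z"
    and Y: "\<And>x. 0 < x \<Longrightarrow> x < X \<Longrightarrow> (Y has_real_derivative - g x / Y x - f x) (at x)"
    and Z: "\<And>x. 0 < x \<Longrightarrow> x < X \<Longrightarrow> (Z has_real_derivative - g x / Z x - f2 x) (at x)"
    and H: "\<And>x. (H has_real_derivative f x - f2 x) (at x)"
    and K: "\<And>x. 0 \<le> x \<Longrightarrow> x \<le> X \<Longrightarrow> \<bar>g x\<bar> \<le> K"
    and \<eta>: "0 < \<eta>" "\<And>x. 0 \<le> x \<Longrightarrow> x \<le> X \<Longrightarrow> \<eta> \<le> Y x \<and> \<eta> \<le> Z x"
  shows "\<bar>(Z X - Y X) - (Z 0 - Y 0) - (H X - H 0)\<bar> \<le> 2 * K / \<eta> * X"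
proof -
  define \<phi> where "\<phi> x = Z x - Y x - H x" for x
  have d: "(\<phi> has_real_derivative g x / Y x - g x / Z x) (at x)" if "0 < x" "x < X" for x
    unfolding \<phi>_def by (rule derivative_eq_intros Y[OF that] Z[OF that] H refl)+ simp
  have cH: "continuous_on {0..X} H"
    using H by (intro continuous_at_imp_continuous_on) (auto intro: DERIV_isCont)
  have "continuous_on {0..X} \<phi>" unfolding \<phi>_def by (intro continuous_intros cont cH)
  then obtain l z where z: "0 < z" "z < X" "(\<phi> has_real_derivative l) (at z)" "\<phi> X - \<phi> 0 = (X - 0) * l"
    using MVT[of 0 X \<phi>] X d real_differentiable_def by blast
  have l: "l = g z / Y z - g z / Z z" using DERIV_unique[OF z(3) d[OF z(1,2)]] .
  have q: "\<bar>g z / v\<bar> \<le> K / \<eta>" if "\<eta> \<le> v" for v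
    unfolding abs_divide using K[of z] z that \<eta> by (intro frac_le) auto
  have "\<bar>l\<bar> \<le> 2 * K / \<eta>"
    using q[of "Y z"] q[of "Z z"] \<eta>(2)[of z] z(1,2) unfolding l by linarith
  then have "\<bar>\<phi> X - \<phi> 0\<bar> \<le> 2 * K / \<eta> * X"
    unfolding z(4) abs_mult using X by (simp only: diff_zero abs_of_pos mult.commute[of X] mult_right_mono less_imp_le)
  then show ?thesis by (simp add: \<phi>_def algebra_simps)
qed

text \<open>
  Two dampings with \<open>f \<ge> f2\<close> beyond \<open>X\<close> such that the integral \<open>H X - H 0\<close> of \<open>f - f2\<close> over
  \<open>[0, X]\<close> is positive. The sign of \<open>f - f2\<close> inside \<open>[0, X]\<close> is arbitrary; instead, the height \<open>\<eta>\<close> is so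
  large that the error in \<open>strip_estimate\<close> is less than this integral.
\<close>

locale damping_comparison =
  fixes g f f2 H :: "real \<Rightarrow> real" and X K \<eta> :: real
  assumes X: "0 < X"
    and right: "\<And>x. X \<le> x \<Longrightarrow> 0 \<le> g x \<and> f2 x \<le> f x"
    and H: "\<And>x. (H has_real_derivative f x - f2 x) (at x)"
    and K: "\<And>x. 0 \<le> x \<Longrightarrow> x \<le> X \<Longrightarrow> \<bar>g x\<bar> \<le> K"
    and \<eta>: "0 < \<eta>" "2 * K * X < \<eta> * (H X - H 0)"
begin

lemma strip_small: "2 * K / \<eta> * X < H X - H 0"
  using \<eta> by (simp add: divide_less_eq mult.commute)

lemma upper_branch_comparison:
  assumes Y: "branch g f Y l" and Z: "branch g f2 Z l2" and l: "X < l" "X < l2"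
    and low: "\<And>x. 0 \<le> x \<Longrightarrow> x \<le> X \<Longrightarrow> \<eta> \<le> Y x \<and> \<eta> \<le> Z x" and start: "Y 0 = Z 0"
  shows "l \<le> l2"
proof (rule ccontr)
  assume "\<not> l \<le> l2"
  then have l2: "l2 < l" by simp
  have "\<bar>(Z X - Y X) - (Z 0 - Y 0) - (H X - H 0)\<bar> \<le> 2 * K / \<eta> * X"
    by (rule strip_estimate[OF X _ _ _ _ H K \<eta>(1) low])
       (use Y Z l in \<open>auto simp: branch_def intro: continuous_on_subset\<close>)
  then have eX: "0 < Z X - Y X" using strip_small start by linarith
  have "Z X - Y X \<le> Z l2 - Y l2"
  proof (rule positive_nondecreasing_where_positive[where e="\<lambda>x. Z x - Y x"])
    show "continuous_on {X..l2} (\<lambda>x. Z x - Y x)"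
      using Y Z l l2 X by (intro continuous_intros) (auto simp: branch_def elim!: continuous_on_subset)
    fix x assume x: "X < x" "x < l2"
    show "((\<lambda>x. Z x - Y x) has_real_derivative (- g x / Z x - f2 x) - (- g x / Y x - f x)) (at x)"
      using Y Z x l2 X by (intro derivative_intros) (auto simp: branch_def)
    assume "0 < Z x - Y x"
    moreover have "0 < Y x" using Y x l2 X by (auto simp: branch_def)
    ultimately have "g x / Z x \<le> g x / Y x" using right[of x] x by (intro divide_left_mono) auto
    then show "0 \<le> (- g x / Z x - f2 x) - (- g x / Y x - f x)" using right[of x] x by simp
  qed (use l eX in auto)
  moreover have "Z l2 = 0" "0 < Y l2" using Y Z l l2 X by (auto simp: branch_def)
  ultimately show False using eX by simp
qed

lemma lower_branch_comparison:
  assumes Y: "branch g (\<lambda>x. - f x) Y l" and Z: "branch g (\<lambda>x. - f2 x) Z l2" and l: "X < l" "l \<le> l2"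
    and low: "\<And>x. 0 \<le> x \<Longrightarrow> x \<le> X \<Longrightarrow> \<eta> \<le> Y x \<and> \<eta> \<le> Z x"
  shows "Y 0 < Z 0"
proof -
  have "Y X - Z X \<le> 0"
  proof (rule ccontr)
    assume "\<not> Y X - Z X \<le> 0"
    then have eX: "0 < Y X - Z X" by simp
    have "Y X - Z X \<le> Y l - Z l"
    proof (rule positive_nondecreasing_where_positive[where e="\<lambda>x. Y x - Z x"])
      show "continuous_on {X..l} (\<lambda>x. Y x - Z x)"
        using Y Z l X by (intro continuous_intros) (auto simp: branch_def elim!: continuous_on_subset)
      fix x assume x: "X < x" "x < l"
      show "((\<lambda>x. Y x - Z x) has_real_derivative (- g x / Y x - - f x) - (- g x / Z x - - f2 x)) (at x)"
        using Y Z x l X by (intro derivative_intros) (auto simp: branch_def)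
      assume "0 < Y x - Z x"
      moreover have "0 < Z x" using Z x l X by (auto simp: branch_def)
      ultimately have "g x / Y x \<le> g x / Z x" using right[of x] x by (intro divide_left_mono) auto
      then show "0 \<le> (- g x / Y x - - f x) - (- g x / Z x - - f2 x)" using right[of x] x by simp
    qed (use l eX in auto)
    moreover have "Y l = 0" "0 \<le> Z l" using Y Z l X by (auto simp: branch_def le_less)
    ultimately show False using eX by simp
  qed
  moreover have "\<bar>(Y X - Z X) - (Y 0 - Z 0) - (H X - H 0)\<bar> \<le> 2 * K / \<eta> * X"
  proof (rule strip_estimate[OF X])
    show "(H has_real_derivative - f2 x - - f x) (at x)" for x using H[of x] by simp
    show "continuous_on {0..X} Z" "continuous_on {0..X} Y"
      using Y Z l by (auto simp: branch_def intro: continuous_on_subset)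
    show "(Z has_real_derivative - g x / Z x - - f2 x) (at x)" "(Y has_real_derivative - g x / Y x - - f x) (at x)"
      if "0 < x" "x < X" for x
      using Y Z l that by (auto simp: branch_def)
    show "\<eta> \<le> Z x \<and> \<eta> \<le> Y x" if "0 \<le> x" "x \<le> X" for x using low[OF that] by blast
  qed (use K \<eta>(1) in blast)+
  ultimately show ?thesis using strip_small by linarith
qed

end

text \<open>
  While \<open>y > 0\<close> the abscissa increases strictly, so time can be replaced by the abscissa.
\<close>

lemma solution_upper_branch:
  assumes t1: "0 < t1"
    and sol: "\<And>t. 0 \<le> t \<Longrightarrow> t \<le> t1 \<Longrightarrow> (\<gamma> has_vector_derivative lienard g f (\<gamma> t)) (at t)"
    and x0: "fst (\<gamma> 0) = 0" and pos: "\<And>t. 0 \<le> t \<Longrightarrow> t < t1 \<Longrightarrow> 0 < snd (\<gamma> t)"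
    and y1: "snd (\<gamma> t1) = 0"
  obtains Y where "branch g f Y (fst (\<gamma> t1))" "Y 0 = snd (\<gamma> 0)"
    "\<And>x. 0 \<le> x \<Longrightarrow> x \<le> fst (\<gamma> t1) \<Longrightarrow> \<exists>t. 0 \<le> t \<and> t \<le> t1 \<and> fst (\<gamma> t) = x \<and> Y x = snd (\<gamma> t)"
proof -
  define x where "x t = fst (\<gamma> t)" for t
  define y where "y t = snd (\<gamma> t)" for t
  define l where "l = x t1"
  have dx: "(x has_real_derivative y t) (at t)" if "0 \<le> t" "t \<le> t1" for t
    unfolding x_def y_def by (rule lienard_solution_components[OF sol[OF that]])
  have dy: "(y has_real_derivative - g (x t) - f (x t) * y t) (at t)" if "0 \<le> t" "t \<le> t1" for t
    unfolding x_def y_def by (rule lienard_solution_components[OF sol[OF that]])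
  have cx: "continuous_on {0..t1} x" and cy: "continuous_on {0..t1} y"
    by (intro continuous_at_imp_continuous_on ballI DERIV_isCont[OF dx] DERIV_isCont[OF dy]; simp)+
  have mono: "x s < x t" if "0 \<le> s" "s < t" "t \<le> t1" for s t
  proof (rule DERIV_pos_imp_increasing_open[where f=x, OF that(2)])
    show "\<exists>d. (x has_real_derivative d) (at r) \<and> 0 < d" if "s < r" "r < t" for r
      using dx[of r] pos[of r] that \<open>0 \<le> s\<close> \<open>t \<le> t1\<close> by (auto simp: y_def)
  qed (use that cx in \<open>auto intro: continuous_on_subset\<close>)
  have inj: "inj_on x {0..t1}"
    by (rule linorder_inj_onI) (use mono in \<open>force+\<close>)
  have x00: "x 0 = 0" by (simp add: x_def x0)
  have img: "x ` {0..t1} = {0..l}"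
  proof
    show "x ` {0..t1} \<subseteq> {0..l}"
    proof safe
      fix t assume t: "t \<in> {0..t1}"
      have "x 0 \<le> x t" using mono[of 0 t] t by (cases "t = 0") auto
      moreover have "x t \<le> x t1" using mono[of t t1] t by (cases "t = t1") auto
      ultimately show "x t \<in> {0..l}" using x00 by (simp add: l_def)
    qed
    show "{0..l} \<subseteq> x ` {0..t1}"
    proof
      fix v assume "v \<in> {0..l}"
      then have "\<exists>t\<ge>0. t \<le> t1 \<and> x t = v" using IVT'[of x 0 v t1] x00 t1 cx by (auto simp: l_def)
      then show "v \<in> x ` {0..t1}" by auto
    qed
  qed
  define \<psi> where "\<psi> = the_inv_into {0..t1} x"
  have \<psi>x: "\<psi> (x t) = t" if "0 \<le> t" "t \<le> t1" for t
    unfolding \<psi>_def using inj that by (simp add: the_inv_into_f_f)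
  have x\<psi>: "x (\<psi> v) = v" "0 \<le> \<psi> v" "\<psi> v \<le> t1" if "0 \<le> v" "v \<le> l" for v
  proof -
    have v: "v \<in> x ` {0..t1}" using that img by simp
    show "x (\<psi> v) = v" unfolding \<psi>_def by (rule f_the_inv_into_f[OF inj v])
    have "\<psi> v \<in> {0..t1}" unfolding \<psi>_def by (rule the_inv_into_into[OF inj v]) simp
    then show "0 \<le> \<psi> v" "\<psi> v \<le> t1" by auto
  qed
  have c\<psi>: "continuous_on {0..l} \<psi>"
    unfolding \<psi>_def img[symmetric] by (rule continuous_on_inv_into[OF cx compact_Icc inj])
  define Y where "Y v = y (\<psi> v)" for v
  have \<psi>lt: "\<psi> v < t1" if "0 \<le> v" "v < l" for v
    using x\<psi>[of v] that by (metis l_def less_le order_less_imp_le)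
  have Ypos: "0 < Y v" if "0 \<le> v" "v < l" for v
    using pos[of "\<psi> v"] \<psi>lt[OF that] x\<psi>[of v] that by (simp add: Y_def y_def)
  have dY: "(Y has_real_derivative - g v / Y v - f v) (at v)" if v: "0 < v" "v < l" for v
  proof -
    have "(\<psi> has_real_derivative inverse (y (\<psi> v))) (at v)"
    proof (rule DERIV_inverse_function[where f=x and a=0 and b=l])
      show "(x has_real_derivative y (\<psi> v)) (at (\<psi> v))" using x\<psi>[of v] v by (intro dx) auto
      show "y (\<psi> v) \<noteq> 0" using Ypos[of v] v by (simp add: Y_def)
      show "isCont \<psi> v" using continuous_on_interior[OF c\<psi>, of v] v by simp
    qed (use v x\<psi> in auto)
    then have "(Y has_real_derivative (- g (x (\<psi> v)) - f (x (\<psi> v)) * y (\<psi> v)) * inverse (y (\<psi> v))) (at v)"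
      unfolding Y_def using x\<psi>[of v] v by (intro DERIV_chain2 dy) auto
    moreover have "(- g (x (\<psi> v)) - f (x (\<psi> v)) * y (\<psi> v)) * inverse (y (\<psi> v)) = - g v / Y v - f v"
      using Ypos[of v] x\<psi>[of v] v by (simp add: Y_def field_simps)
    ultimately show ?thesis by simp
  qed
  have "continuous_on {0..l} Y"
    unfolding Y_def by (rule continuous_on_compose2[OF cy c\<psi>]) (use x\<psi> in auto)
  then have "branch g f Y (fst (\<gamma> t1))"
    unfolding branch_def l_def[symmetric, unfolded x_def]
    using Ypos dY \<psi>x[of t1] t1 y1 by (auto simp: Y_def l_def y_def)
  moreover have "Y 0 = snd (\<gamma> 0)" using \<psi>x[of 0] t1 x00 by (simp add: Y_def y_def)
  moreover have "\<exists>t. 0 \<le> t \<and> t \<le> t1 \<and> fst (\<gamma> t) = v \<and> Y v = snd (\<gamma> t)" if "0 \<le> v" "v \<le> fst (\<gamma> t1)" for v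
    using x\<psi>[of v] that by (intro exI[of _ "\<psi> v"]) (auto simp: Y_def l_def x_def y_def)
  ultimately show ?thesis using that by blast
qed

text \<open>
  A passage through the right half-plane from the positive to the negative \<open>y\<close>-axis that crosses the
  \<open>x\<close>-axis exactly once. The last condition expresses this without naming the crossing time.
\<close>

definition half_turn ::
    "(real \<Rightarrow> real) \<Rightarrow> (real \<Rightarrow> real) \<Rightarrow> (real \<Rightarrow> real \<times> real) \<Rightarrow> real \<Rightarrow> bool" where
  "half_turn g f \<gamma> \<tau> \<longleftrightarrow> 0 \<le> \<tau> \<and>
     (\<forall>t. 0 \<le> t \<and> t \<le> \<tau> \<longrightarrow> (\<gamma> has_vector_derivative lienard g f (\<gamma> t)) (at t) \<and> 0 \<le> fst (\<gamma> t)) \<and>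
     fst (\<gamma> 0) = 0 \<and> fst (\<gamma> \<tau>) = 0 \<and> 0 < snd (\<gamma> 0) \<and> snd (\<gamma> \<tau>) < 0 \<and>
     (\<forall>s t. 0 \<le> s \<and> s < t \<and> t \<le> \<tau> \<and> snd (\<gamma> s) \<le> 0 \<longrightarrow> snd (\<gamma> t) < 0)"

lemma half_turn_branches:
  assumes h: "half_turn g f \<gamma> \<tau>" and \<eta>: "0 < \<eta>"
    and strip: "\<And>t. 0 \<le> t \<Longrightarrow> t \<le> \<tau> \<Longrightarrow> fst (\<gamma> t) \<le> X \<Longrightarrow> \<eta> \<le> \<bar>snd (\<gamma> t)\<bar>"
  obtains Y Z l where "X < l" "branch g f Y l" "branch g (\<lambda>x. - f x) Z l"
    "Y 0 = snd (\<gamma> 0)" "Z 0 = - snd (\<gamma> \<tau>)"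
    "\<forall>x\<in>{0..X}. \<eta> \<le> Y x \<and> \<eta> \<le> Z x"
proof -
  have \<tau>: "0 \<le> \<tau>" and sol: "\<And>t. 0 \<le> t \<Longrightarrow> t \<le> \<tau> \<Longrightarrow> (\<gamma> has_vector_derivative lienard g f (\<gamma> t)) (at t)"
    and ends: "fst (\<gamma> 0) = 0" "fst (\<gamma> \<tau>) = 0" "0 < snd (\<gamma> 0)" "snd (\<gamma> \<tau>) < 0"
    and sign: "\<And>s t. 0 \<le> s \<Longrightarrow> s < t \<Longrightarrow> t \<le> \<tau> \<Longrightarrow> snd (\<gamma> s) \<le> 0 \<Longrightarrow> snd (\<gamma> t) < 0"
    using h unfolding half_turn_def by blast+
  have "continuous_on {0..\<tau>} \<gamma>"
    by (intro continuous_at_imp_continuous_on ballI has_vector_derivative_continuous[OF sol]; simp)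
  then have "continuous_on {0..\<tau>} (\<lambda>t. snd (\<gamma> t))" by (intro continuous_intros)
  then obtain t1 where t1: "0 \<le> t1" "t1 \<le> \<tau>" "snd (\<gamma> t1) = 0"
    using IVT2'[of "\<lambda>t. snd (\<gamma> t)" \<tau> 0 0] \<tau> ends by auto
  have t1': "0 < t1" "t1 < \<tau>" using t1 ends by (auto simp: less_le)
  define l where "l = fst (\<gamma> t1)"
  have l: "X < l" using strip[of t1] t1 \<eta> by (force simp: l_def)
  have pos: "0 < snd (\<gamma> t)" if "0 \<le> t" "t < t1" for t
    using sign[of t t1] that t1 by (force simp: not_less)
  have neg: "snd (\<gamma> t) < 0" if "t1 < t" "t \<le> \<tau>" for t using sign[of t1 t] that t1 by simp
  have sol1: "(\<gamma> has_vector_derivative lienard g f (\<gamma> t)) (at t)" if "0 \<le> t" "t \<le> t1" for t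
    using sol that t1 by simp
  obtain Y where Y: "branch g f Y l" "Y 0 = snd (\<gamma> 0)"
    "\<And>x. 0 \<le> x \<Longrightarrow> x \<le> l \<Longrightarrow> \<exists>t. 0 \<le> t \<and> t \<le> t1 \<and> fst (\<gamma> t) = x \<and> Y x = snd (\<gamma> t)"
    using solution_upper_branch[OF t1'(1) sol1 ends(1) pos t1(3)] unfolding l_def by blast
  define \<delta> where "\<delta> t = flip (\<gamma> (\<tau> - t))" for t
  have \<delta>sol: "(\<delta> has_vector_derivative lienard g (\<lambda>x. - f x) (\<delta> t)) (at t)" if "0 \<le> t" "t \<le> \<tau> - t1" for t
  proof -
    have "(\<gamma> has_vector_derivative lienard g f (\<gamma> (\<tau> - t))) (at (\<tau> - t))"
      using that t1 by (intro sol) auto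
    from bounded_linear.has_vector_derivative[OF bounded_linear_flip has_vector_derivative_reflect[OF this]]
    show ?thesis
      unfolding \<delta>_def lienard_flip by (simp add: linear_neg[OF bounded_linear.linear[OF bounded_linear_flip]])
  qed
  have \<delta>pos: "0 < snd (\<delta> t)" if "0 \<le> t" "t < \<tau> - t1" for t
    using neg[of "\<tau> - t"] that by (simp add: \<delta>_def)
  have \<delta>1: "0 < \<tau> - t1" "fst (\<delta> 0) = 0" "snd (\<delta> (\<tau> - t1)) = 0" "fst (\<delta> (\<tau> - t1)) = l"
    using t1' ends t1 by (simp_all add: \<delta>_def l_def)
  obtain Z where Z: "branch g (\<lambda>x. - f x) Z l" "Z 0 = snd (\<delta> 0)"
    "\<And>x. 0 \<le> x \<Longrightarrow> x \<le> l \<Longrightarrow> \<exists>t. 0 \<le> t \<and> t \<le> \<tau> - t1 \<and> fst (\<delta> t) = x \<and> Z x = snd (\<delta> t)"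
    using solution_upper_branch[OF \<delta>1(1) \<delta>sol \<delta>1(2) \<delta>pos \<delta>1(3)] unfolding \<delta>1(4) by blast
  show ?thesis
  proof
    show "X < l" "branch g f Y l" "branch g (\<lambda>x. - f x) Z l" "Y 0 = snd (\<gamma> 0)" "Z 0 = - snd (\<gamma> \<tau>)"
      using l Y Z by (simp_all add: \<delta>_def)
    show "\<forall>x\<in>{0..X}. \<eta> \<le> Y x \<and> \<eta> \<le> Z x"
    proof safe
      fix x assume x: "x \<in> {0..X}"
      obtain t where t: "0 \<le> t" "t \<le> t1" "fst (\<gamma> t) = x" "Y x = snd (\<gamma> t)" using Y(3)[of x] x l by auto
      have "0 \<le> Y x" using Y(1) x l by (auto simp: branch_def le_less)
      then show "\<eta> \<le> Y x" using strip[of t] t t1 x by simp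
      obtain t where t: "0 \<le> t" "t \<le> \<tau> - t1" "fst (\<delta> t) = x" "Z x = snd (\<delta> t)" using Z(3)[of x] x l by auto
      have "0 \<le> Z x" using Z(1) x l by (auto simp: branch_def le_less)
      then show "\<eta> \<le> Z x" using strip[of "\<tau> - t"] t t1 x by (simp add: \<delta>_def)
    qed
  qed
qed

text \<open>
  The stronger damping gives the half turn that ends nearer to the origin.
\<close>

lemma (in damping_comparison) half_turn_comparison:
  assumes \<gamma>: "half_turn g f \<gamma> \<tau>" and \<delta>: "half_turn g f2 \<delta> \<sigma>" and start: "snd (\<gamma> 0) = snd (\<delta> 0)"
    and strip: "\<And>t. 0 \<le> t \<Longrightarrow> t \<le> \<tau> \<Longrightarrow> fst (\<gamma> t) \<le> X \<Longrightarrow> \<eta> \<le> \<bar>snd (\<gamma> t)\<bar>"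
      "\<And>t. 0 \<le> t \<Longrightarrow> t \<le> \<sigma> \<Longrightarrow> fst (\<delta> t) \<le> X \<Longrightarrow> \<eta> \<le> \<bar>snd (\<delta> t)\<bar>"
  shows "snd (\<delta> \<sigma>) < snd (\<gamma> \<tau>)"
proof -
  obtain Y Z l where Y: "X < l" "branch g f Y l" "branch g (\<lambda>x. - f x) Z l"
    "Y 0 = snd (\<gamma> 0)" "Z 0 = - snd (\<gamma> \<tau>)"
    "\<forall>x\<in>{0..X}. \<eta> \<le> Y x \<and> \<eta> \<le> Z x"
    by (rule half_turn_branches[OF \<gamma> \<eta>(1) strip(1)])
  obtain Y' Z' l' where Y': "X < l'" "branch g f2 Y' l'" "branch g (\<lambda>x. - f2 x) Z' l'"
    "Y' 0 = snd (\<delta> 0)" "Z' 0 = - snd (\<delta> \<sigma>)"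
    "\<forall>x\<in>{0..X}. \<eta> \<le> Y' x \<and> \<eta> \<le> Z' x"
    by (rule half_turn_branches[OF \<delta> \<eta>(1) strip(2)])
  have "l \<le> l'" by (rule upper_branch_comparison[OF Y(2) Y'(2) Y(1) Y'(1)]) (use Y Y' start in auto)
  then have "Z 0 < Z' 0" by (rule lower_branch_comparison[OF Y(3) Y'(3) Y(1)]) (use Y Y' in auto)
  then show ?thesis using Y Y' by simp
qed

lemma (in right_rotation) half_turn_of_solution:
  assumes p: "fst (\<gamma> 0) = 0" "0 < snd (\<gamma> 0)" "M * R \<le> snd (\<gamma> 0)"
    and sol: "\<And>t. (\<gamma> has_vector_derivative lienard g f (\<gamma> t)) (at t)"
  obtains \<tau> where "half_turn g f \<gamma> \<tau>"
    "\<And>t. 0 \<le> t \<Longrightarrow> t \<le> \<tau> \<Longrightarrow> snd (\<gamma> 0) / M \<le> radius (\<gamma> t)"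
proof -
  have r: "radius (\<gamma> 0) = snd (\<gamma> 0)" using p by (simp add: radius_def u_0)
  have cont: "continuous_on UNIV \<gamma>"
    using sol by (intro continuous_at_imp_continuous_on) (auto intro: has_vector_derivative_continuous)
  obtain \<tau> where \<tau>: "0 \<le> \<tau>" "fst (\<gamma> \<tau>) = 0" "snd (\<gamma> \<tau>) < 0"
    and bd: "\<And>s. 0 \<le> s \<Longrightarrow> s \<le> \<tau> \<Longrightarrow> 0 \<le> fst (\<gamma> s) \<and> radius (\<gamma> 0) / M \<le> radius (\<gamma> s) \<and> radius (\<gamma> s) \<le> M * radius (\<gamma> 0)"
    and sg: "\<And>s t. 0 \<le> s \<Longrightarrow> s < t \<Longrightarrow> t \<le> \<tau> \<Longrightarrow> snd (\<gamma> s) \<le> 0 \<Longrightarrow> snd (\<gamma> t) < 0"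
    by (rule forward_half_turn[OF _ _ refl cont sol]) (use p r in auto)
  have "half_turn g f \<gamma> \<tau>"
    unfolding half_turn_def using \<tau> bd sg sol p by blast
  then show ?thesis using that bd unfolding r by blast
qed

lemma half_turn_reverse:
  assumes "half_turn g (\<lambda>x. - f x) \<delta> \<tau>"
  shows "half_turn g f (\<lambda>t. flip (\<delta> (\<tau> - t))) \<tau>"
proof -
  note h = assms[unfolded half_turn_def]
  have flip: "lienard g f (flip q) = - flip (lienard g (\<lambda>x. - f x) q)" for q
    by (cases q) simp
  have "((\<lambda>t. flip (\<delta> (\<tau> - t))) has_vector_derivative lienard g f (flip (\<delta> (\<tau> - t)))) (at t)"
    if "0 \<le> t" "t \<le> \<tau>" for t
  proof -
    have "(\<delta> has_vector_derivative lienard g (\<lambda>x. - f x) (\<delta> (\<tau> - t))) (at (\<tau> - t))"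
      using h that by auto
    from bounded_linear.has_vector_derivative[OF bounded_linear_flip has_vector_derivative_reflect[OF this]]
    show ?thesis
      unfolding flip by (simp add: linear_neg[OF bounded_linear.linear[OF bounded_linear_flip]])
  qed
  moreover have "snd (flip (\<delta> (\<tau> - t))) < 0"
    if st: "0 \<le> s" "s < t" "t \<le> \<tau>" "snd (flip (\<delta> (\<tau> - s))) \<le> 0" for s t
  proof (rule ccontr)
    assume "\<not> snd (flip (\<delta> (\<tau> - t))) < 0"
    then have "snd (\<delta> (\<tau> - t)) \<le> 0" by simp
    moreover have "0 \<le> \<tau> - t" "\<tau> - t < \<tau> - s" "\<tau> - s \<le> \<tau>" using st by auto
    ultimately have "snd (\<delta> (\<tau> - s)) < 0" using h by blast
    then show False using st by simp
  qed
  ultimately show ?thesis unfolding half_turn_def using h by auto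
qed

lemma (in right_rotation) far_in_strip:
  assumes strip: "\<And>x. 0 \<le> x \<Longrightarrow> x \<le> X \<Longrightarrow> u x \<le> U"
    and \<eta>: "0 < \<eta>" and r: "U + \<eta> \<le> radius q" and q: "0 \<le> fst q" "fst q \<le> X"
  shows "\<eta> \<le> \<bar>snd q\<bar>"
proof -
  have u: "0 \<le> u (fst q)" "u (fst q) \<le> U" using u_ge[OF q(1)] q strip by auto
  have "radius q \<le> \<bar>u (fst q)\<bar> + \<bar>snd q\<bar>"
    unfolding radius_def by (rule sqrt_sum_squares_le_sum_abs)
  then show ?thesis using u r by simp
qed

lemma compact_closed_orbit:
  assumes "closed_orbit X C" shows "compact C"
proof -
  obtain \<gamma> T where \<gamma>: "\<And>t. (\<gamma> has_vector_derivative X (\<gamma> t)) (at t)" and T: "0 < T"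
    and per: "\<And>t. \<gamma> (t + T) = \<gamma> t" and C: "C = range \<gamma>"
    using assms unfolding closed_orbit_def by blast
  have "C \<subseteq> \<gamma> ` {0..T}"
  proof
    fix q assume "q \<in> C"
    then obtain t where "q = \<gamma> t" using C by blast
    moreover obtain s where "0 \<le> s" "s < 0 + T" "\<gamma> s = \<gamma> t"
      by (rule periodic_representative[where \<gamma>=\<gamma> and a=0 and t=t, OF T per])
    ultimately show "q \<in> \<gamma> ` {0..T}" by (intro image_eqI[of _ _ s]) auto
  qed
  then have "C = \<gamma> ` {0..T}" using C by blast
  moreover have "continuous_on {0..T} \<gamma>"
    by (intro continuous_at_imp_continuous_on ballI has_vector_derivative_continuous[OF \<gamma>])
  ultimately show ?thesis by (simp add: compact_continuous_image)
qed

text \<open>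
  Let \<open>(0, - ys)\<close> be the lowest point of a far closed orbit on the \<open>y\<close>-axis. Backwards in time, a half
  turn in the right half-plane leads from it to a point \<open>(0, yb)\<close>, and from there a half turn in the
  left half-plane leads to a point \<open>(0, - y')\<close>. By comparison \<open>y' > ys\<close>, a contradiction.
\<close>

lemma no_center_of_unequal_half_turns:
  assumes rot: "right_rotation u u' g f R c C" "right_rotation u u' g (\<lambda>x. - f (- x)) R' c' C'"
    and odd: "odd_fun g"
    and comparison: "damping_comparison g f (\<lambda>x. - f (- x)) H X K \<eta>"
  shows "\<not> center_at_infinity (lienard g f)"
proof
  assume "center_at_infinity (lienard g f)"
  then obtain R0 where R0: "\<And>p. R0 \<le> norm p \<Longrightarrow> \<exists>C. closed_orbit (lienard g f) C \<and> p \<in> C"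
    unfolding center_at_infinity_iff by blast
  interpret right: right_rotation u u' g f R c C by (rule rot(1))
  interpret rev: right_rotation u u' g "\<lambda>x. - f x" R c C by (rule right.right_rotation_neg)
  interpret left: right_rotation u u' g "\<lambda>x. - f (- x)" R' c' C' by (rule rot(2))
  interpret damping_comparison g f "\<lambda>x. - f (- x)" H X K \<eta> by (rule comparison)
  have "continuous_on {0..X} u"
    using right.deriv_u by (intro continuous_at_imp_continuous_on) (auto intro: DERIV_isCont)
  then obtain v where "\<forall>x\<in>{0..X}. u x \<le> u v"
    using continuous_attains_sup[of "{0..X}" u] X by (metis atLeastAtMost_iff compact_Icc empty_iff less_imp_le order_refl)
  then obtain U where U: "\<And>x. 0 \<le> x \<Longrightarrow> x \<le> X \<Longrightarrow> u x \<le> U"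
    by (intro that[of "u v"]) auto
  have U0: "0 \<le> U" using U[of 0] X right.u_0 by simp
  define r where "r = U + \<eta>"
  have r: "0 < r" using U0 \<eta>(1) by (simp add: r_def)
  have Ms: "1 < right.M" "1 < left.M" by (rule right.M_gt_1 left.M_gt_1)+
  \<comment> \<open>Far enough for both half turns to exist and to have \<open>\<bar>y\<bar> \<ge> \<eta>\<close> over the strip \<open>0 \<le> x \<le> X\<close>; each half turn may cost a factor \<open>M\<close>.\<close>
  define Y0 where "Y0 = \<bar>R0\<bar> + right.M * R + right.M * r + right.M * (left.M * R') + right.M * (left.M * r)"
  have terms: "0 < right.M * R" "0 < right.M * r" "0 < right.M * (left.M * R')" "0 < right.M * (left.M * r)"
    using Ms right.R_pos left.R_pos r by auto
  then have Y0: "R0 \<le> Y0" "right.M * R \<le> Y0" "right.M * r \<le> Y0" "right.M * (left.M * R') \<le> Y0"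
      "right.M * (left.M * r) \<le> Y0" "0 < Y0"
    unfolding Y0_def using abs_ge_self[of R0] by linarith+
  obtain D where D: "closed_orbit (lienard g f) D" "(0, - Y0) \<in> D"
    using R0[of "(0, - Y0)"] Y0 by auto
  have cpt: "compact (D \<inter> {q. fst q = 0})"
    by (intro compact_Int_closed compact_closed_orbit[OF D(1)] closed_Collect_eq continuous_intros)
  have ne: "D \<inter> {q. fst q = 0} \<noteq> {}" using D(2) by auto
  obtain q where q: "q \<in> D \<inter> {q. fst q = 0}" and min': "\<forall>q'\<in>D \<inter> {q. fst q = 0}. snd q \<le> snd q'"
    using continuous_attains_inf[OF cpt ne continuous_on_snd[OF continuous_on_id]] by blast
  have min: "snd q \<le> snd q'" if "q' \<in> D \<inter> {q. fst q = 0}" for q' using min' that by blast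
  define ys where "ys = - snd q"
  have ys: "Y0 \<le> ys" using min[of "(0, - Y0)"] D by (simp add: ys_def)
  obtain \<gamma> T where \<gamma>: "\<And>t. (\<gamma> has_vector_derivative lienard g f (\<gamma> t)) (at t)" and \<gamma>0: "\<gamma> 0 = q"
    and C: "D = range \<gamma>"
    using closed_orbit_cases[OF D(1), of q] q by (metis IntD1)
  define \<delta> where "\<delta> t = flip (\<gamma> (0 - t))" for t
  have \<delta>: "(\<delta> has_vector_derivative lienard g (\<lambda>x. - f x) (\<delta> t)) (at t)" for t
    using bounded_linear.has_vector_derivative[OF bounded_linear_flip has_vector_derivative_reflect[OF \<gamma>[of "0 - t"]]]
    unfolding \<delta>_def lienard_flip by (simp add: linear_neg[OF bounded_linear.linear[OF bounded_linear_flip]])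
  have \<delta>0: "fst (\<delta> 0) = 0" "snd (\<delta> 0) = ys" using q by (simp_all add: \<delta>_def \<gamma>0 ys_def)
  obtain \<tau> where \<tau>: "half_turn g (\<lambda>x. - f x) \<delta> \<tau>"
    "\<And>t. 0 \<le> t \<Longrightarrow> t \<le> \<tau> \<Longrightarrow> ys / right.M \<le> right.radius (\<delta> t)"
    using rev.half_turn_of_solution[OF \<delta>0(1) _ _ \<delta>] \<delta>0 ys Y0 by auto
  have ends\<tau>: "0 \<le> \<tau>" "fst (\<delta> \<tau>) = 0" "snd (\<delta> \<tau>) < 0" using \<tau>(1) by (simp_all add: half_turn_def)
  define yb where "yb = - snd (\<delta> \<tau>)"
  have yb: "ys / right.M \<le> yb"
    using \<tau>(2)[of \<tau>] ends\<tau> by (simp add: right.radius_def right.u_0 yb_def)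
  define \<epsilon> where "\<epsilon> t = mirror (\<gamma> (- \<tau> - t))" for t
  have \<epsilon>: "(\<epsilon> has_vector_derivative lienard g (\<lambda>x. - f (- x)) (\<epsilon> t)) (at t)" for t
    using bounded_linear.has_vector_derivative[OF bounded_linear_mirror has_vector_derivative_reflect[OF \<gamma>[of "- \<tau> - t"]]]
    unfolding \<epsilon>_def lienard_mirror[OF odd] by (simp add: linear_neg[OF bounded_linear.linear[OF bounded_linear_mirror]])
  have \<epsilon>0: "fst (\<epsilon> 0) = 0" "snd (\<epsilon> 0) = yb" using ends\<tau> by (simp_all add: \<epsilon>_def \<delta>_def yb_def)
  have big: "r \<le> ys / right.M" "left.M * R' \<le> ys / right.M" "left.M * r \<le> ys / right.M"
    using ys Y0 Ms by (simp_all add: le_divide_eq mult.commute)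
  have "left.M * R' \<le> yb" "left.M * r \<le> yb" "0 < yb" using big yb r by linarith+
  moreover from this have "r \<le> yb / left.M" using Ms by (simp add: le_divide_eq mult.commute)
  ultimately obtain \<sigma> where \<sigma>: "half_turn g (\<lambda>x. - f (- x)) \<epsilon> \<sigma>"
    "\<And>t. 0 \<le> t \<Longrightarrow> t \<le> \<sigma> \<Longrightarrow> r \<le> left.radius (\<epsilon> t)"
    using left.half_turn_of_solution[OF \<epsilon>0(1) _ _ \<epsilon>] \<epsilon>0 by (metis order_trans)
  have "snd (\<epsilon> \<sigma>) < snd (flip (\<delta> (\<tau> - \<tau>)))"
  proof (rule half_turn_comparison[OF half_turn_reverse[OF \<tau>(1)] \<sigma>(1)])
    show "snd (flip (\<delta> (\<tau> - 0))) = snd (\<epsilon> 0)" using \<epsilon>0 by (simp add: yb_def)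
    show "\<eta> \<le> \<bar>snd (flip (\<delta> (\<tau> - t)))\<bar>" if "0 \<le> t" "t \<le> \<tau>" "fst (flip (\<delta> (\<tau> - t))) \<le> X" for t
    proof (rule right.far_in_strip[OF U \<eta>(1)])
      have "r \<le> right.radius (\<delta> (\<tau> - t))" using \<tau>(2)[of "\<tau> - t"] big that by simp
      then show "U + \<eta> \<le> right.radius (flip (\<delta> (\<tau> - t)))" by (simp add: r_def right.radius_def)
      show "0 \<le> fst (flip (\<delta> (\<tau> - t)))" using \<tau>(1) that by (simp add: half_turn_def)
    qed (use that in auto)
    show "\<eta> \<le> \<bar>snd (\<epsilon> t)\<bar>" if "0 \<le> t" "t \<le> \<sigma>" "fst (\<epsilon> t) \<le> X" for t
      by (rule left.far_in_strip[OF U \<eta>(1)]) (use \<sigma> that in \<open>auto simp: half_turn_def r_def\<close>)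
  qed
  then have "snd (\<epsilon> \<sigma>) < snd q" using \<delta>0(2) by (simp add: ys_def)
  moreover have "\<gamma> (- \<tau> - \<sigma>) \<in> D \<inter> {q. fst q = 0}"
    using \<sigma>(1) C by (auto simp: half_turn_def \<epsilon>_def)
  then have "snd q \<le> snd (\<epsilon> \<sigma>)" using min[of "\<gamma> (- \<tau> - \<sigma>)"] by (simp add: \<epsilon>_def)
  ultimately show False by simp
qed

section \<open>Polynomial coefficients\<close>

lemma poly_sum_asymp:
  fixes c :: "nat \<Rightarrow> real"
  assumes "p \<le> q"
  shows "((\<lambda>x. (\<Sum>i=p..q. c i * x ^ i) / x ^ q) \<longlongrightarrow> c q) at_top"
proof -
  have "((\<lambda>x::real. c i * x ^ i / x ^ q) \<longlongrightarrow> (if i = q then c q else 0)) at_top" if "i \<in> {p..q}" for i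
  proof (cases "i = q")
    case True
    have "\<forall>\<^sub>F x::real in at_top. c q = c i * x ^ i / x ^ q"
      using eventually_gt_at_top[of 0] by eventually_elim (simp add: True)
    then have "((\<lambda>x::real. c i * x ^ i / x ^ q) \<longlongrightarrow> c q) at_top"
      by (rule Lim_transform_eventually[OF tendsto_const])
    then show ?thesis using True by simp
  next
    case False
    have "((\<lambda>x::real. c i / x ^ (q - i)) \<longlongrightarrow> 0) at_top"
      using that False by (intro tendsto_divide_0[OF tendsto_const] filterlim_at_top_imp_at_infinity
          filterlim_pow_at_top filterlim_ident) auto
    moreover have "\<forall>\<^sub>F x::real in at_top. c i / x ^ (q - i) = c i * x ^ i / x ^ q"
      using eventually_gt_at_top[of 0]
      by eventually_elim (use that in \<open>simp add: power_diff\<close>)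
    ultimately show ?thesis using False by (auto elim: Lim_transform_eventually)
  qed
  then have "((\<lambda>x. \<Sum>i=p..q. c i * x ^ i / x ^ q) \<longlongrightarrow> (\<Sum>i=p..q. if i = q then c q else 0)) at_top"
    by (rule tendsto_sum)
  then show ?thesis using assms by (simp add: sum_divide_distrib)
qed

lemma poly_sum_eventually_pos:
  fixes c :: "nat \<Rightarrow> real"
  assumes "p \<le> q" "0 < c q"
  shows "\<forall>\<^sub>F x in at_top. 0 < (\<Sum>i=p..q. c i * x ^ i)"
  using order_tendstoD(1)[OF poly_sum_asymp[OF assms(1), of c] assms(2)] eventually_gt_at_top[of 0]
  by eventually_elim (simp add: zero_less_divide_iff)

lemma poly_sum_remainder:
  fixes c :: "nat \<Rightarrow> real"
  assumes "p \<le> q" "1 \<le> x"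
  shows "\<bar>(\<Sum>i=p..q. c i * x ^ i) - c q * x ^ q\<bar> \<le> (\<Sum>i=p..q. \<bar>c i\<bar>) * x ^ q / x"
proof -
  have "(\<Sum>i=p..q. c i * x ^ i) - c q * x ^ q = (\<Sum>i\<in>{p..q} - {q}. c i * x ^ i)"
    using assms by (subst sum.remove[of _ q]) auto
  also have "\<bar>\<dots>\<bar> \<le> (\<Sum>i\<in>{p..q} - {q}. \<bar>c i\<bar> * (x ^ q / x))"
  proof (rule order_trans[OF sum_abs sum_mono])
    fix i assume i: "i \<in> {p..q} - {q}"
    have "x ^ i * x = x ^ Suc i" by simp
    also have "\<dots> \<le> x ^ q" using i assms by (intro power_increasing) auto
    finally have "x ^ i \<le> x ^ q / x" using assms by (simp add: le_divide_eq)
    then show "\<bar>c i * x ^ i\<bar> \<le> \<bar>c i\<bar> * (x ^ q / x)"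
      unfolding abs_mult using assms by (intro mult_left_mono) auto
  qed
  also have "\<dots> \<le> (\<Sum>i=p..q. \<bar>c i\<bar> * (x ^ q / x))"
    using assms by (intro sum_mono2) auto
  also have "\<dots> = (\<Sum>i=p..q. \<bar>c i\<bar>) * (x ^ q / x)" by (rule sum_distrib_right[symmetric])
  finally show ?thesis by simp
qed

lemma poly_sum_minus_arg:
  fixes c :: "nat \<Rightarrow> real"
  shows "(\<Sum>i=p..q. c i * (- x) ^ i) = (\<Sum>i=p..q. (c i * (-1) ^ i) * x ^ i)"
  by (rule sum.cong) (simp_all add: power_minus[of x])

lemma odd_degree_of_odd_fun:
  fixes c :: "nat \<Rightarrow> real"
  assumes h: "\<And>x. h x = (\<Sum>i=p..q. c i * x ^ i)" and "p \<le> q" "c q \<noteq> 0" "odd_fun h"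
  shows "odd q"
proof -
  have "((\<lambda>x. - h (- x) / x ^ q) \<longlongrightarrow> - (c q * (-1) ^ q)) at_top"
    unfolding h poly_sum_minus_arg
    using tendsto_minus[OF poly_sum_asymp[OF assms(2), of "\<lambda>i. c i * (-1) ^ i"]] by simp
  moreover have "((\<lambda>x. - h (- x) / x ^ q) \<longlongrightarrow> c q) at_top"
    using poly_sum_asymp[OF assms(2), of c] assms(4) by (simp add: h[symmetric] odd_fun_def)
  ultimately have "- (c q * (-1) ^ q) = c q"
    by (rule tendsto_unique[rotated]) simp
  then show ?thesis using assms(3) by (cases "even q") auto
qed

lemma poly_sum_lipschitz_on_interval:
  fixes c :: "nat \<Rightarrow> real"
  shows "\<exists>L. L-lipschitz_on {a..b} (\<lambda>x. \<Sum>i=p..q. c i * x ^ i)"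
  by (rule continuous_derivative_imp_lipschitz_on_interval[where h'="\<lambda>x. \<Sum>i=p..q. c i * (of_nat i * x ^ (i - 1))"])
     (auto intro!: derivative_eq_intros continuous_intros sum.cong)

text \<open>
  For \<open>x\<close> large the quadratic form \<open>u' y\<^sup>2 + f u y + g u\<close> dominates \<open>u' (y\<^sup>2 - \<beta> u \<bar>y\<bar> + \<kappa> u\<^sup>2)\<close>, which
  is positive definite since \<open>\<beta>\<^sup>2 < 4 \<kappa>\<close>. For \<open>x\<close> bounded, a point of large radius has \<open>\<bar>y\<bar>\<close> much
  larger than \<open>u\<close>, and the term \<open>u' y\<^sup>2\<close> prevails.
\<close>

lemma right_rotation_of_asymptotic_bounds:
  fixes u u' g f :: "real \<Rightarrow> real"
  assumes du: "\<And>x. (u has_real_derivative u' x) (at x)" and u0: "u 0 = 0"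
    and u_ge: "\<And>x. 0 \<le> x \<Longrightarrow> x \<le> u x" and u'_ge: "\<And>x. 0 \<le> x \<Longrightarrow> 1 \<le> u' x"
    and f: "\<And>x. 0 \<le> x \<Longrightarrow> \<bar>f x\<bar> \<le> F * u' x" and g: "\<And>x. 0 \<le> x \<Longrightarrow> \<bar>g x\<bar> \<le> G * (u x * u' x)"
    and far: "\<forall>\<^sub>F x in at_top. \<bar>f x\<bar> \<le> \<beta> * u' x \<and> \<kappa> * (u x * u' x) \<le> g x"
    and disc: "0 \<le> \<beta>" "0 < \<kappa>" "\<beta>\<^sup>2 < 4 * \<kappa>"
  shows "\<exists>R c C. right_rotation u u' g f R c C"
proof -
  have F: "0 \<le> F" using f[of 0] u'_ge[of 0] by (smt (verit) mult_less_0_iff)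
  have G: "0 \<le> G"
    using g[of 1] u'_ge[of 1] u_ge[of 1] by (smt (verit) mult_less_0_iff mult_pos_pos)
  obtain X0 where X0: "\<And>x. X0 \<le> x \<Longrightarrow> \<bar>f x\<bar> \<le> \<beta> * u' x \<and> \<kappa> * (u x * u' x) \<le> g x"
    using far unfolding eventually_at_top_linorder by blast
  define X where "X = max X0 0"
  define U where "U = u X"
  have U: "0 \<le> U" using u_ge[of X] by (simp add: U_def X_def)
  have u_mono: "u x \<le> U" if "0 \<le> x" "x \<le> X" for x
    unfolding U_def
  proof (rule DERIV_nonneg_imp_nondecreasing[where f=u, OF that(2)])
    show "\<exists>d. (u has_real_derivative d) (at r) \<and> 0 \<le> d" if "x \<le> r" for r
      using du[of r] u'_ge[of r] that \<open>0 \<le> x\<close> by (intro exI[of _ "u' r"]) auto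
  qed
  define \<Lambda> where "\<Lambda> = 2 * (F + G + 1)"
  have \<Lambda>: "2 \<le> \<Lambda>" using F G by (simp add: \<Lambda>_def)
  define R where "R = U + \<Lambda> * U + 1"
  \<comment> \<open>Chosen such that \<open>4 (\<kappa> - c1 (1 + \<kappa>)) = \<beta>\<^sup>2\<close>; then \<open>4 (1 - c1) (\<kappa> - c1) \<ge> \<beta>\<^sup>2\<close>.\<close>
  define c1 where "c1 = (4 * \<kappa> - \<beta>\<^sup>2) / (4 * (1 + \<kappa>))"
  have c1: "0 < c1" "c1 < 1" "c1 < \<kappa>" "\<beta>\<^sup>2 \<le> 4 * ((1 - c1) * (\<kappa> - c1))"
  proof -
    show "0 < c1" using disc by (simp add: c1_def)
    have eq: "c1 * (4 * (1 + \<kappa>)) = 4 * \<kappa> - \<beta>\<^sup>2" using disc by (simp add: c1_def)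
    show "c1 < 1" using disc by (simp add: c1_def divide_less_eq) (smt (verit) zero_le_power2)
    have "c1 * (1 + \<kappa>) \<le> \<kappa>" using eq zero_le_power2[of \<beta>] by linarith
    moreover have "c1 < c1 * (1 + \<kappa>)" using \<open>0 < c1\<close> disc by simp
    ultimately show "c1 < \<kappa>" by linarith
    have "4 * ((1 - c1) * (\<kappa> - c1)) = 4 * \<kappa> - c1 * (4 * (1 + \<kappa>)) + 4 * c1\<^sup>2"
      by (simp add: algebra_simps power2_eq_square)
    then show "\<beta>\<^sup>2 \<le> 4 * ((1 - c1) * (\<kappa> - c1))" using eq by simp
  qed
  have form: "c1 * (v\<^sup>2 + y\<^sup>2) \<le> y\<^sup>2 - \<beta> * v * \<bar>y\<bar> + \<kappa> * v\<^sup>2" for v y :: real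
  proof -
    have "4 * (1 - c1) * ((1 - c1) * y\<^sup>2 - \<beta> * v * \<bar>y\<bar> + (\<kappa> - c1) * v\<^sup>2)
        = (2 * (1 - c1) * \<bar>y\<bar> - \<beta> * v)\<^sup>2 + (4 * ((1 - c1) * (\<kappa> - c1)) - \<beta>\<^sup>2) * v\<^sup>2"
      by (simp add: power2_eq_square algebra_simps)
    also have "\<dots> \<ge> 0" using c1(4) by (intro add_nonneg_nonneg mult_nonneg_nonneg) auto
    finally have "0 \<le> (1 - c1) * y\<^sup>2 - \<beta> * v * \<bar>y\<bar> + (\<kappa> - c1) * v\<^sup>2"
      using c1(2) by (simp add: zero_le_mult_iff)
    then show ?thesis by (simp add: algebra_simps)
  qed
  define c where "c = min c1 (1/2)"
  have turning: "c * u' x * ((u x)\<^sup>2 + y\<^sup>2) \<le> u' x * y\<^sup>2 + f x * u x * y + g x * u x"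
    if x: "0 \<le> x" and r: "R\<^sup>2 \<le> (u x)\<^sup>2 + y\<^sup>2" for x y
  proof -
    have ux: "0 \<le> u x" and u'x: "0 < u' x" using u_ge[OF x] u'_ge[OF x] x by auto
    have lower: "u' x * (y\<^sup>2 - b * u x * \<bar>y\<bar> + k * (u x)\<^sup>2) \<le> u' x * y\<^sup>2 + f x * u x * y + g x * u x"
      if "\<bar>f x\<bar> \<le> b * u' x" "k * (u x * u' x) \<le> g x" for b k
    proof -
      have "\<bar>f x * u x * y\<bar> \<le> (b * u' x) * u x * \<bar>y\<bar>"
        unfolding abs_mult using that ux by (intro mult_right_mono mult_mono) auto
      moreover have "k * (u x * u' x) * u x \<le> g x * u x" using that ux by (intro mult_right_mono)
      ultimately show ?thesis by (simp add: algebra_simps power2_eq_square abs_le_iff)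
    qed
    have cc: "c * ((u x)\<^sup>2 + y\<^sup>2) \<le> d * ((u x)\<^sup>2 + y\<^sup>2)" if "c \<le> d" for d
      using that by (intro mult_right_mono) auto
    have "c * ((u x)\<^sup>2 + y\<^sup>2) * u' x \<le> u' x * y\<^sup>2 + f x * u x * y + g x * u x"
    proof (cases "X \<le> x")
      case True
      have "c * ((u x)\<^sup>2 + y\<^sup>2) \<le> y\<^sup>2 - \<beta> * u x * \<bar>y\<bar> + \<kappa> * (u x)\<^sup>2"
        using form[where v="u x" and y=y] cc[of c1] by (simp add: c_def)
      then have "c * ((u x)\<^sup>2 + y\<^sup>2) * u' x \<le> u' x * (y\<^sup>2 - \<beta> * u x * \<bar>y\<bar> + \<kappa> * (u x)\<^sup>2)"
        using u'x by (simp add: mult.commute)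
      also note lower[of \<beta> \<kappa>]
      finally show ?thesis using X0[of x] True by (simp add: X_def)
    next
      case False
      have uU: "u x \<le> U" using u_mono[OF x] False by simp
      have "(\<Lambda> * U)\<^sup>2 + U\<^sup>2 \<le> R\<^sup>2"
        using U \<Lambda> by (simp add: R_def power2_eq_square algebra_simps)
      moreover have "(u x)\<^sup>2 \<le> U\<^sup>2" using uU ux by (intro power_mono)
      ultimately have "(\<Lambda> * U)\<^sup>2 \<le> y\<^sup>2" using r by linarith
      then have "\<Lambda> * U \<le> \<bar>y\<bar>" using U \<Lambda> by (simp add: abs_le_square_iff[symmetric] abs_mult)
      moreover have "\<Lambda> * u x \<le> \<Lambda> * U" using uU \<Lambda> by (intro mult_left_mono) auto
      ultimately have y: "\<Lambda> * u x \<le> \<bar>y\<bar>" by linarith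
      have "1 * u x \<le> \<Lambda> * u x" using \<Lambda> ux by (intro mult_right_mono) auto
      then have y1: "u x \<le> \<bar>y\<bar>" using y by linarith
      have arith: "1/2 * (v + w) \<le> w - F * a + (- G) * v"
        if "(F + G + 1) * a \<le> w / 2" "(G + 1) * v \<le> (G + 1) * a" "0 \<le> v" for a v w :: real
        using that unfolding distrib_right distrib_left mult_1 by linarith
      have 1: "(F + G + 1) * (u x * \<bar>y\<bar>) \<le> y\<^sup>2 / 2"
      proof -
        have "(\<Lambda> * u x) * \<bar>y\<bar> \<le> \<bar>y\<bar> * \<bar>y\<bar>" using y by (intro mult_right_mono) auto
        then show ?thesis by (simp add: \<Lambda>_def power2_eq_square algebra_simps)
      qed
      have "(u x)\<^sup>2 \<le> u x * \<bar>y\<bar>" unfolding power2_eq_square using y1 ux by (intro mult_left_mono)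
      then have 2: "(G + 1) * (u x)\<^sup>2 \<le> (G + 1) * (u x * \<bar>y\<bar>)" using G by (intro mult_left_mono) auto
      have "1/2 * ((u x)\<^sup>2 + y\<^sup>2) \<le> y\<^sup>2 - F * u x * \<bar>y\<bar> + (- G) * (u x)\<^sup>2"
        using arith[OF 1 2 zero_le_power2] by (simp only: mult.assoc)
      moreover have "c * ((u x)\<^sup>2 + y\<^sup>2) \<le> 1/2 * ((u x)\<^sup>2 + y\<^sup>2)" by (rule cc) (simp add: c_def)
      ultimately have "c * ((u x)\<^sup>2 + y\<^sup>2) \<le> y\<^sup>2 - F * u x * \<bar>y\<bar> + (- G) * (u x)\<^sup>2"
        by linarith
      then have "c * ((u x)\<^sup>2 + y\<^sup>2) * u' x \<le> u' x * (y\<^sup>2 - F * u x * \<bar>y\<bar> + (- G) * (u x)\<^sup>2)"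
        using u'x by (simp add: mult.commute)
      also note lower[of F "- G"]
      finally show ?thesis using f[OF x] g[OF x] by (simp add: abs_le_iff)
    qed
    then show ?thesis by (simp add: mult_ac)
  qed
  have growth: "\<bar>u x * u' x * y - g x * y - f x * y\<^sup>2\<bar> \<le> (1 + G + F) * u' x * ((u x)\<^sup>2 + y\<^sup>2)"
    if x: "0 \<le> x" for x y
  proof -
    have ux: "0 \<le> u x" and u'x: "0 < u' x" using u_ge[OF x] u'_ge[OF x] x by auto
    have uy: "u x * \<bar>y\<bar> \<le> (u x)\<^sup>2 + y\<^sup>2"
      using sum_squares_bound[of "u x" "\<bar>y\<bar>"] ux by (simp add: mult.assoc) (smt (verit) mult_nonneg_nonneg abs_ge_zero)
    have 1: "\<bar>u x * u' x * y\<bar> \<le> u' x * ((u x)\<^sup>2 + y\<^sup>2)"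
      using mult_left_mono[OF uy, of "u' x"] ux u'x by (simp add: abs_mult mult_ac)
    have "\<bar>g x * y\<bar> \<le> (G * (u x * u' x)) * \<bar>y\<bar>"
      unfolding abs_mult using g[OF x] by (intro mult_right_mono) auto
    also have "\<dots> \<le> G * u' x * ((u x)\<^sup>2 + y\<^sup>2)"
      using mult_left_mono[OF uy, of "G * u' x"] G u'x by (simp add: mult_ac)
    finally have 2: "\<bar>g x * y\<bar> \<le> G * u' x * ((u x)\<^sup>2 + y\<^sup>2)" .
    have "\<bar>f x * y\<^sup>2\<bar> \<le> (F * u' x) * y\<^sup>2"
      unfolding abs_mult using f[OF x] by (simp add: mult_right_mono)
    also have "\<dots> \<le> F * u' x * ((u x)\<^sup>2 + y\<^sup>2)" using F u'x by (intro mult_left_mono) auto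
    finally have 3: "\<bar>f x * y\<^sup>2\<bar> \<le> F * u' x * ((u x)\<^sup>2 + y\<^sup>2)" .
    have "\<bar>u x * u' x * y - g x * y - f x * y\<^sup>2\<bar>
        \<le> u' x * ((u x)\<^sup>2 + y\<^sup>2) + G * u' x * ((u x)\<^sup>2 + y\<^sup>2) + F * u' x * ((u x)\<^sup>2 + y\<^sup>2)"
      using 1 2 3 by linarith
    then show ?thesis by (simp add: algebra_simps)
  qed
  have "right_rotation u u' g f R c (1 + G + F)"
  proof
    show "0 < R" "0 < c" using U \<Lambda> c1 by (auto simp: R_def c_def add_nonneg_pos)
  qed (use du u0 u_ge u'_ge turning growth in auto)
  then show ?thesis by blast
qed

text \<open>
  The exponent \<open>N\<close> gives \<open>u u'\<close> the order \<open>x ^ (2 N - 1) = x ^ m\<close> of \<open>g\<close>; the summand \<open>x\<close> of \<open>u\<close> keeps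
  \<open>u' \<ge> 1\<close> near \<open>0\<close>.
\<close>

lemma lienard_right_rotation:
  fixes a b :: "nat \<Rightarrow> real"
  assumes g: "\<And>x. g x = (\<Sum>i=k..m. a i * x ^ i)" and f: "\<And>x. f x = (\<Sum>i=s..n. b i * x ^ i)"
    and km: "1 \<le> k" "k \<le> m" and sn: "s \<le> n" and N: "m + 1 = 2 * N" "n + 1 \<le> N"
    and am: "0 < a m" and disc: "n + 1 = N \<Longrightarrow> (b n)\<^sup>2 < 4 * real N * a m"
  shows "\<exists>R c C. right_rotation (\<lambda>x. x + x ^ N) (\<lambda>x. 1 + real N * x ^ (N - 1)) g f R c C"
proof -
  define u where "u = (\<lambda>x::real. x + x ^ N)"
  define u' where "u' = (\<lambda>x::real. 1 + real N * x ^ (N - 1))"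
  have N1: "1 \<le> N" using N by simp
  have u'_low: "1 + x ^ (N - 1) \<le> u' x" if "0 \<le> x" for x
    using N1 that mult_right_mono[of 1 "real N" "x ^ (N - 1)"] by (simp add: u'_def)
  have u'_ge: "1 \<le> u' x" if "0 \<le> x" for x
    using u'_low[OF that] zero_le_power[OF that, of "N - 1"] by linarith
  have xm: "x ^ m = x ^ N * x ^ (N - 1)" for x :: real
  proof -
    have "m = N + (N - 1)" using N by simp
    then show ?thesis by (simp only: power_add)
  qed
  have uu'_low: "x + x ^ m \<le> u x * u' x" if "0 \<le> x" for x
  proof -
    have "x + x ^ m \<le> (x + x ^ N) * (1 + x ^ (N - 1))"
      using that by (simp add: xm algebra_simps)
    also have "\<dots> \<le> u x * u' x" unfolding u_def using u'_low[OF that] that by (intro mult_left_mono) auto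
    finally show ?thesis .
  qed
  have sandwich: "x ^ i \<le> x ^ p + x ^ q" if "0 \<le> x" "p \<le> i" "i \<le> q" for x :: real and i p q
  proof (cases "x \<le> 1")
    case True
    then have "x ^ i \<le> x ^ p" using that by (intro power_decreasing)
    then show ?thesis using zero_le_power[OF that(1), of q] by linarith
  next
    case False
    then have "x ^ i \<le> x ^ q" using that by (intro power_increasing) auto
    then show ?thesis using zero_le_power[OF that(1), of p] by linarith
  qed
  have fb: "\<bar>f x\<bar> \<le> (\<Sum>i=s..n. \<bar>b i\<bar>) * u' x" if "0 \<le> x" for x
  proof -
    have "\<bar>f x\<bar> \<le> (\<Sum>i=s..n. \<bar>b i\<bar> * u' x)" unfolding f
    proof (rule order_trans[OF sum_abs sum_mono])
      fix i assume "i \<in> {s..n}"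
      then have "i \<le> N - 1" using N(2) unfolding atLeastAtMost_iff by linarith
      then have "x ^ i \<le> u' x" using sandwich[OF that, of 0 i "N - 1"] u'_low[OF that] by simp
      then show "\<bar>b i * x ^ i\<bar> \<le> \<bar>b i\<bar> * u' x" using that by (simp add: abs_mult mult_left_mono)
    qed
    then show ?thesis by (simp add: sum_distrib_right)
  qed
  have gb: "\<bar>g x\<bar> \<le> (\<Sum>i=k..m. \<bar>a i\<bar>) * (u x * u' x)" if "0 \<le> x" for x
  proof -
    have "\<bar>g x\<bar> \<le> (\<Sum>i=k..m. \<bar>a i\<bar> * (u x * u' x))" unfolding g
    proof (rule order_trans[OF sum_abs sum_mono])
      fix i assume "i \<in> {k..m}"
      then have "x ^ i \<le> u x * u' x" using sandwich[OF that, of 1 i m] uu'_low[OF that] km by simp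
      then show "\<bar>a i * x ^ i\<bar> \<le> \<bar>a i\<bar> * (u x * u' x)" using that by (simp add: abs_mult mult_left_mono)
    qed
    then show ?thesis by (simp add: sum_distrib_right)
  qed
  \<comment> \<open>The limit of \<open>x / x ^ N\<close>; for \<open>N = 1\<close> the two summands of \<open>u\<close> coincide.\<close>
  define \<epsilon> where "\<epsilon> = (if N = 1 then 1 else 0 :: real)"
  define \<mu> where "\<mu> = real N + \<epsilon>"
  have \<mu>: "0 < \<mu>" "(1 + \<epsilon>) * real N = \<mu>" using N1 by (auto simp: \<mu>_def \<epsilon>_def)
  have inv: "((\<lambda>x::real. 1 / x ^ (N - 1)) \<longlongrightarrow> \<epsilon>) at_top"
  proof (cases "N = 1")
    case False
    then have "((\<lambda>x::real. 1 / x ^ (N - 1)) \<longlongrightarrow> 0) at_top"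
      using N1 by (intro tendsto_divide_0[OF tendsto_const] filterlim_at_top_imp_at_infinity
          filterlim_pow_at_top filterlim_ident) auto
    then show ?thesis using False by (simp add: \<epsilon>_def)
  qed (simp add: \<epsilon>_def)
  have u'_lim: "((\<lambda>x. u' x / x ^ (N - 1)) \<longlongrightarrow> \<mu>) at_top"
  proof -
    have "((\<lambda>x::real. 1 / x ^ (N - 1) + real N) \<longlongrightarrow> \<epsilon> + real N) at_top"
      by (intro tendsto_intros inv)
    moreover have "\<forall>\<^sub>F x::real in at_top. 1 / x ^ (N - 1) + real N = u' x / x ^ (N - 1)"
      using eventually_gt_at_top[of 0] by eventually_elim (simp add: u'_def add_divide_distrib)
    ultimately show ?thesis by (auto simp: \<mu>_def add.commute elim: Lim_transform_eventually)
  qed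
  have u_lim: "((\<lambda>x. u x / x ^ N) \<longlongrightarrow> 1 + \<epsilon>) at_top"
  proof -
    have "((\<lambda>x::real. 1 + 1 / x ^ (N - 1)) \<longlongrightarrow> 1 + \<epsilon>) at_top"
      by (intro tendsto_intros inv)
    moreover have "\<forall>\<^sub>F x::real in at_top. 1 + 1 / x ^ (N - 1) = u x / x ^ N"
      using eventually_gt_at_top[of 0]
    proof eventually_elim
      case (elim x)
      have "x ^ N = x * x ^ (N - 1)" using N1 by (cases N) auto
      then show ?case using elim by (simp add: u_def field_simps)
    qed
    ultimately show ?thesis by (rule Lim_transform_eventually)
  qed
  define A where "A = a m * real N / \<mu>\<^sup>2"
  define B where "B = (if n + 1 = N then b n / \<mu> else 0)"
  have g_lim: "((\<lambda>x. g x / (u x * u' x)) \<longlongrightarrow> A) at_top"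
  proof -
    have "((\<lambda>x. (g x / x ^ m) / ((u x / x ^ N) * (u' x / x ^ (N - 1)))) \<longlongrightarrow> a m / ((1 + \<epsilon>) * \<mu>)) at_top"
      unfolding g using \<mu> N1 by (intro tendsto_intros poly_sum_asymp km u_lim u'_lim) (auto simp: \<epsilon>_def)
    moreover have "a m / ((1 + \<epsilon>) * \<mu>) = A"
    proof -
      have "1 + \<epsilon> = \<mu> / real N" using \<mu>(2) N1 by (simp add: field_simps)
      then show ?thesis by (simp add: A_def power2_eq_square)
    qed
    moreover have "\<forall>\<^sub>F x in at_top. (g x / x ^ m) / ((u x / x ^ N) * (u' x / x ^ (N - 1))) = g x / (u x * u' x)"
      using eventually_gt_at_top[of 0]
    proof eventually_elim
      case (elim x)
      then show ?case by (simp add: xm field_simps)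
    qed
    ultimately show ?thesis by (auto elim: Lim_transform_eventually)
  qed
  have f_lim: "((\<lambda>x. f x / u' x) \<longlongrightarrow> B) at_top"
  proof -
    have "((\<lambda>x. x ^ n / x ^ (N - 1)) \<longlongrightarrow> (if n + 1 = N then 1 else 0 :: real)) at_top"
    proof -
      have nN: "n \<le> N - 1" using N(2) by linarith
      have "(\<Sum>i=n..N - 1. (if i = n then 1 else 0) * x ^ i) = (\<Sum>i=n..N - 1. if i = n then x ^ n else 0)"
        for x :: real by (rule sum.cong) auto
      then have "(\<Sum>i=n..N - 1. (if i = n then 1 else 0) * x ^ i) = x ^ n" for x :: real
        using nN by simp
      moreover have "N - 1 = n \<longleftrightarrow> n + 1 = N" using N1 by linarith
      ultimately show ?thesis
        using poly_sum_asymp[OF nN, of "\<lambda>i. if i = n then 1 else 0"] by presburger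
    qed
    then have "((\<lambda>x. (f x / x ^ n) * (x ^ n / x ^ (N - 1)) / (u' x / x ^ (N - 1))) \<longlongrightarrow>
        b n * (if n + 1 = N then 1 else 0) / \<mu>) at_top"
      unfolding f using \<mu> by (intro tendsto_intros poly_sum_asymp sn u'_lim) auto
    moreover have "b n * (if n + 1 = N then 1 else 0) / \<mu> = B" by (simp add: B_def)
    moreover have "\<forall>\<^sub>F x in at_top. (f x / x ^ n) * (x ^ n / x ^ (N - 1)) / (u' x / x ^ (N - 1)) = f x / u' x"
      using eventually_gt_at_top[of 0] by eventually_elim simp
    ultimately show ?thesis by (auto elim: Lim_transform_eventually)
  qed
  have A: "0 < A" using am \<mu> N1 by (simp add: A_def)
  have AB: "B\<^sup>2 < 4 * A"
  proof (cases "n + 1 = N")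
    case True
    then show ?thesis using disc \<mu> by (simp add: A_def B_def power_divide divide_strict_right_mono mult_ac)
  qed (use A in \<open>simp add: B_def\<close>)
  \<comment> \<open>Constants strictly between the limits, with the discriminant still negative.\<close>
  define \<kappa> where "\<kappa> = (B\<^sup>2 / 4 + A) / 2"
  have \<kappa>: "0 < \<kappa>" "\<kappa> < A" "B\<^sup>2 < 4 * \<kappa>"
    using A AB by (auto simp: \<kappa>_def intro: add_nonneg_pos)
  define \<beta> where "\<beta> = (\<bar>B\<bar> + sqrt (4 * \<kappa>)) / 2"
  have "\<bar>B\<bar> < sqrt (4 * \<kappa>)" using \<kappa> real_less_rsqrt[of "\<bar>B\<bar>" "4 * \<kappa>"] by simp
  then have \<beta>: "\<bar>B\<bar> < \<beta>" "\<beta> < sqrt (4 * \<kappa>)" by (simp_all add: \<beta>_def)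
  then have \<beta>2: "\<beta>\<^sup>2 < 4 * \<kappa>" using \<kappa> by (metis abs_of_pos abs_ge_zero order_le_less_trans real_less_lsqrt real_sqrt_abs real_sqrt_less_iff)
  have "\<forall>\<^sub>F x in at_top. \<bar>f x / u' x\<bar> < \<beta>"
    using order_tendstoD(2)[OF tendsto_rabs[OF f_lim] \<beta>(1)] .
  moreover have "\<forall>\<^sub>F x in at_top. \<kappa> < g x / (u x * u' x)"
    using order_tendstoD(1)[OF g_lim \<kappa>(2)] .
  ultimately have far: "\<forall>\<^sub>F x in at_top. \<bar>f x\<bar> \<le> \<beta> * u' x \<and> \<kappa> * (u x * u' x) \<le> g x"
    using eventually_gt_at_top[of 0]
  proof eventually_elim
    case (elim x)
    have "0 < u' x" using u'_ge[of x] elim by simp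
    moreover have "0 < u x" using elim by (simp add: u_def add_pos_pos)
    ultimately have "0 < u' x" "0 < u x * u' x" by auto
    then show ?case using elim by (simp add: abs_divide divide_less_eq less_divide_eq)
  qed
  show ?thesis
    unfolding u_def[symmetric] u'_def[symmetric]
  proof (rule right_rotation_of_asymptotic_bounds[OF _ _ _ u'_ge fb gb far _ \<kappa>(1) \<beta>2])
    show "(u has_real_derivative u' x) (at x)" for x
      unfolding u_def u'_def by (auto intro!: derivative_eq_intros)
    show "u 0 = 0" using N1 by (simp add: u_def)
    show "x \<le> u x" if "0 \<le> x" for x using that by (simp add: u_def)
    show "0 \<le> \<beta>" using \<beta>(1) by simp
  qed
qed

lemma center_at_infinity_excludes_barrier:
  assumes "center_at_infinity (lienard g f)"
    and h: "\<And>x. X \<le> x \<Longrightarrow> (h has_real_derivative h' x) (at x)"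
    and h0: "\<And>x. X \<le> x \<Longrightarrow> 0 \<le> h x"
    and barrier: "\<And>x. X \<le> x \<Longrightarrow> h' x * h x < - g x - f x * h x"
  shows False
proof -
  obtain R where R: "\<And>p. R \<le> norm p \<Longrightarrow> \<exists>C. closed_orbit (lienard g f) C \<and> p \<in> C"
    using assms(1) unfolding center_at_infinity_iff by blast
  define x0 where "x0 = max \<bar>R\<bar> X + 1"
  have "R \<le> \<bar>x0\<bar>" by (simp add: x0_def)
  also have "\<dots> \<le> norm (x0, h x0)" using norm_fst_le[of x0 "h x0"] by simp
  finally obtain C where C: "closed_orbit (lienard g f) C" "(x0, h x0) \<in> C" using R by blast
  have "X < x0" by (simp add: x0_def)
  then show False using no_closed_orbit_through_barrier[OF h h0 barrier _ C(1)] C(2) by blast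
qed

lemma center_at_infinity_imp_restoring:
  fixes a :: "nat \<Rightarrow> real"
  assumes center: "center_at_infinity (lienard g f)"
    and g: "\<And>x. g x = (\<Sum>i=k..m. a i * x ^ i)" and km: "k \<le> m"
  shows "0 \<le> a m"
proof (rule ccontr)
  assume "\<not> 0 \<le> a m"
  then have "\<forall>\<^sub>F x in at_top. 0 < (\<Sum>i=k..m. - a i * x ^ i)"
    using poly_sum_eventually_pos[OF km, of "\<lambda>i. - a i"] by simp
  then obtain X where X: "\<And>x. X \<le> x \<Longrightarrow> 0 < - g x"
    unfolding eventually_at_top_linorder by (auto simp: g sum_negf)
  show False
    by (rule center_at_infinity_excludes_barrier[OF center, of X "\<lambda>_. 0" "\<lambda>_. 0"]) (use X in auto)
qed

text \<open>
  The barrier is \<open>h x = A x ^ (n + 1) + x ^ n sqrt x\<close>. The value \<open>A = - b n / (2 (n + 1))\<close> maximizes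
  \<open>- b n A - (n + 1) A\<^sup>2\<close>, and the maximum \<open>\<alpha> = (b n)\<^sup>2 / (4 (n + 1))\<close> bounds the coefficient of
  \<open>x ^ (2 n + 1)\<close> in \<open>g\<close>. The summand \<open>x ^ n sqrt x\<close> contributes a positive term of order
  \<open>x ^ (2 n) sqrt x\<close>, which dominates the remainders, of order \<open>x ^ (2 n)\<close>.
\<close>

lemma no_center_strong_negative_damping:
  fixes a b :: "nat \<Rightarrow> real"
  assumes center: "center_at_infinity (lienard g f)"
    and g: "\<And>x. g x = (\<Sum>i=k..m. a i * x ^ i)" and f: "\<And>x. f x = (\<Sum>i=s..n. b i * x ^ i)"
    and km: "k \<le> m" and sn: "s \<le> n" and bn: "b n < 0"
    and mn: "m \<le> 2 * n + 1" and disc: "m = 2 * n + 1 \<Longrightarrow> 4 * (real n + 1) * a m \<le> (b n)\<^sup>2"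
  shows False
proof -
  define \<beta> where "\<beta> = - b n"
  define F where "F = (\<Sum>i=s..n. \<bar>b i\<bar>)"
  define G where "G = (\<Sum>i=k..m. \<bar>a i\<bar>)"
  define \<alpha> where "\<alpha> = \<beta>\<^sup>2 / (4 * (real n + 1))"
  define A where "A = \<beta> / (2 * (real n + 1))"
  have \<beta>: "0 < \<beta>" using bn by (simp add: \<beta>_def)
  have A: "0 < A" and \<alpha>: "0 \<le> \<alpha>" using \<beta> by (simp_all add: A_def \<alpha>_def)
  have F: "0 \<le> F" and G: "0 \<le> G" by (simp_all add: F_def G_def sum_nonneg)
  have fb: "\<beta> * x ^ n - F * x ^ n / x \<le> - f x" if "1 \<le> x" for x
    using poly_sum_remainder[OF sn that, of b] unfolding f[symmetric] by (simp add: \<beta>_def F_def abs_le_iff)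
  have gb: "g x \<le> \<alpha> * x * x ^ (2 * n) + G * x ^ (2 * n)" if x: "1 \<le> x" for x
  proof -
    have r: "g x \<le> a m * x ^ m + G * x ^ m / x"
      using poly_sum_remainder[OF km x, of a] unfolding g[symmetric] by (simp add: G_def abs_le_iff)
    show ?thesis
    proof (cases "m = 2 * n + 1")
      case True
      have "a m \<le> \<alpha>" using disc[OF True] by (simp add: \<alpha>_def \<beta>_def le_divide_eq mult.commute)
      then have "a m * (x * x ^ (2 * n)) \<le> \<alpha> * (x * x ^ (2 * n))" using x by (intro mult_right_mono) auto
      moreover have "g x \<le> a m * (x * x ^ (2 * n)) + G * x ^ (2 * n)" using r x by (simp add: True)
      ultimately show ?thesis unfolding mult.assoc by linarith
    next
      case False
      have "\<bar>g x\<bar> \<le> (\<Sum>i=k..m. \<bar>a i\<bar> * x ^ (2 * n))" unfolding g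
      proof (rule order_trans[OF sum_abs sum_mono])
        fix i assume "i \<in> {k..m}"
        then have "x ^ i \<le> x ^ (2 * n)" using mn False x by (intro power_increasing) auto
        then show "\<bar>a i * x ^ i\<bar> \<le> \<bar>a i\<bar> * x ^ (2 * n)" using x by (simp add: abs_mult mult_left_mono)
      qed
      then have "g x \<le> G * x ^ (2 * n)" by (simp add: G_def sum_distrib_right)
      moreover have "0 \<le> \<alpha> * x * x ^ (2 * n)" using \<alpha> x by simp
      ultimately show ?thesis by linarith
    qed
  qed
  define W where "W = max 1 ((real n + 1/2 + F * A + F + G + 1) / (\<beta> / (4 * (real n + 1))))"
  define h where "h = (\<lambda>x. x ^ n * (A * x + sqrt x))"
  define h' where "h' = (\<lambda>x. x ^ n * (A * (real n + 1) + (real n + 1/2) / sqrt x))"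
  have x1: "1 \<le> x" and Wx: "W \<le> sqrt x" if "W\<^sup>2 \<le> x" for x
  proof -
    have "1 \<le> W" by (simp add: W_def)
    then have "1\<^sup>2 \<le> W\<^sup>2" by (intro power_mono) auto
    then show "1 \<le> x" using that by simp
    show "W \<le> sqrt x" using that by (rule real_le_rsqrt)
  qed
  show False
  proof (rule center_at_infinity_excludes_barrier[OF center, of "W\<^sup>2" h h'])
    fix x assume x: "W\<^sup>2 \<le> x"
    note 1 = x1[OF x]
    define w where "w = sqrt x"
    have w: "1 \<le> w" "W \<le> w" "w * w = x" using 1 Wx[OF x] by (simp_all add: w_def)
    show "0 \<le> h x" using 1 A by (simp add: h_def)
    show "(h has_real_derivative h' x) (at x)"
    proof -
      have "(h has_real_derivative
          (real n * x ^ (n - 1)) * (A * x + sqrt x) + (A + inverse (sqrt x) / 2) * x ^ n) (at x)"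
        unfolding h_def using 1 by (auto intro!: derivative_eq_intros)
      moreover have "(real n * x ^ (n - 1)) * (A * x + sqrt x) + (A + inverse (sqrt x) / 2) * x ^ n = h' x"
      proof (cases n)
        case 0
        then show ?thesis by (simp add: h'_def field_simps)
      next
        case (Suc q)
        have id: "r * p * (A * (v * v) + v) + (A + inverse v / 2) * (v * v * p)
            = v * v * p * (A * (r + 1) + (r + 1/2) / v)" if "v \<noteq> 0" for r p v :: real
          using that by (simp add: field_simps)
        have xn: "x ^ n = w * w * x ^ (n - 1)" unfolding w(3) by (simp add: Suc)
        show ?thesis
          unfolding h'_def w_def[symmetric] xn using id[of w "real n" "x ^ (n - 1)"] w by simp
      qed
      ultimately show ?thesis by simp
    qed
    define S where "S = A * x + w"
    have S: "0 < S" "h x = x ^ n * S" using 1 A w by (simp_all add: S_def h_def w_def[symmetric] add_pos_pos)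
    define D where "D = \<beta> - F / x - (A * (real n + 1) + (real n + 1/2) / w)"
    have xn: "0 < x ^ n" using 1 by simp
    have D: "x ^ n * D \<le> - f x - h' x"
      using fb[OF 1] by (simp add: D_def h'_def w_def[symmetric] algebra_simps)
    have key: "\<alpha> * x + G < S * D"
    proof -
      have half: "\<beta> - A * (real n + 1) = \<beta> / 2" by (simp add: A_def field_simps)
      have S1: "S / x \<le> A + 1"
      proof -
        have "w \<le> x" using w mult_right_mono[of 1 w w] by simp
        then show ?thesis using 1 by (simp add: S_def add_divide_distrib)
      qed
      have "S * D = S * (\<beta> / 2) - F * (S / x) - S * ((real n + 1/2) / w)"
        unfolding D_def half[symmetric] by (simp add: algebra_simps)
      moreover have "F * (S / x) \<le> F * (A + 1)" using S1 F by (intro mult_left_mono)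
      moreover have "F * (A + 1) = F * A + F" by (simp add: algebra_simps)
      moreover have "S * ((real n + 1/2) / w) = A * (real n + 1/2) * w + (real n + 1/2)"
        using w by (simp add: S_def w(3)[symmetric] field_simps)
      moreover have "S * (\<beta> / 2) = \<alpha> * x + w * (\<beta> / 2)"
        by (simp add: S_def \<alpha>_def A_def field_simps power2_eq_square)
      moreover have "w * (\<beta> / 2) - A * (real n + 1/2) * w = w * (\<beta> / (4 * (real n + 1)))"
        by (simp add: A_def field_simps)
      moreover have "real n + 1/2 + F * A + F + G + 1 \<le> w * (\<beta> / (4 * (real n + 1)))"
      proof -
        have "0 < \<beta> / (4 * (real n + 1))" using \<beta> by simp
        moreover have "(real n + 1/2 + F * A + F + G + 1) / (\<beta> / (4 * (real n + 1))) \<le> w"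
          using w(2) unfolding W_def max.bounded_iff by blast
        ultimately show ?thesis by (simp only: pos_divide_le_eq)
      qed
      ultimately show ?thesis by linarith
    qed
    have "g x \<le> x ^ n * x ^ n * (\<alpha> * x + G)"
    proof -
      have "x ^ (2 * n) = x ^ n * x ^ n" by (simp add: mult_2 power_add)
      then show ?thesis using gb[OF 1] by (simp add: algebra_simps)
    qed
    also have "\<dots> < x ^ n * x ^ n * (S * D)" using key xn by simp
    also have "\<dots> = h x * (x ^ n * D)" using S by (simp add: mult_ac)
    also have "\<dots> \<le> h x * (- f x - h' x)" using D S xn by (intro mult_left_mono) auto
    finally show "h' x * h x < - g x - f x * h x" by (simp add: algebra_simps)
  qed
qed

lemma center_at_infinity_imp_weak_damping:
  fixes a b :: "nat \<Rightarrow> real"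
  assumes center: "center_at_infinity (lienard g f)"
    and g: "\<And>x. g x = (\<Sum>i=k..m. a i * x ^ i)" and f: "\<And>x. f x = (\<Sum>i=s..n. b i * x ^ i)"
    and km: "k \<le> m" and sn: "s \<le> n" and bn: "b n \<noteq> 0"
  shows "2 * n + 1 < m \<or> m = 2 * n + 1 \<and> (b n)\<^sup>2 < 4 * (real n + 1) * a m"
proof (rule ccontr)
  assume "\<not> ?thesis"
  then have mn: "m \<le> 2 * n + 1" "m = 2 * n + 1 \<Longrightarrow> 4 * (real n + 1) * a m \<le> (b n)\<^sup>2" by auto
  show False
  proof (cases "b n < 0")
    case True
    then show False using no_center_strong_negative_damping[OF center g f km sn _ mn] by blast
  next
    case False
    have "- f x = (\<Sum>i=s..n. (- b i) * x ^ i)" for x by (simp add: f sum_negf)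
    then show False
      using no_center_strong_negative_damping[OF center_at_infinity_flip[OF center] g _ km sn _ mn(1), of "\<lambda>i. - b i"]
        False bn mn(2) by simp
  qed
qed

text \<open>
  The coefficients \<open>d\<close> are those of twice the even part of \<open>f\<close>, and \<open>d j\<close> is the leading one.
\<close>

lemma no_center_positive_even_part:
  fixes a b d :: "nat \<Rightarrow> real"
  assumes center: "center_at_infinity (lienard g f)" and odd: "odd_fun g"
    and g: "\<And>x. g x = (\<Sum>i=k..m. a i * x ^ i)" and km: "k \<le> m" and am: "0 < a m"
    and rot: "right_rotation u u' g f R c C" "right_rotation u u' g (\<lambda>x. - f (- x)) R' c' C'"
    and even: "\<And>x. f x + f (- x) = (\<Sum>i=s..j. d i * x ^ i)" and sj: "s \<le> j" and dj: "0 < d j"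
  shows False
proof -
  define H where "H = (\<lambda>x. \<Sum>i=s..j. d i / real (i + 1) * x ^ (i + 1))"
  have H: "(H has_real_derivative f x - (- f (- x))) (at x)" for x
  proof -
    have "(H has_real_derivative (\<Sum>i=s..j. d i * x ^ i)) (at x)"
      unfolding H_def
    proof (rule DERIV_sum)
      fix i
      show "((\<lambda>x. d i / real (i + 1) * x ^ (i + 1)) has_real_derivative d i * x ^ i) (at x)"
        by (rule DERIV_cong[OF DERIV_cmult[OF DERIV_pow]]) (simp del: of_nat_add of_nat_Suc)
    qed
    then show ?thesis by (simp add: even)
  qed
  have H0: "H 0 = 0" by (simp add: H_def)
  have Hx: "H x = x * (\<Sum>i=s..j. d i / real (i + 1) * x ^ i)" for x
    unfolding H_def sum_distrib_left by (rule sum.cong) simp_all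
  have "\<forall>\<^sub>F x in at_top. 0 < g x"
    unfolding g by (rule poly_sum_eventually_pos[where c=a, OF km am])
  moreover have "\<forall>\<^sub>F x in at_top. 0 < f x + f (- x)"
    unfolding even by (rule poly_sum_eventually_pos[where c=d, OF sj dj])
  moreover have "\<forall>\<^sub>F x in at_top. 0 < (\<Sum>i=s..j. d i / real (i + 1) * x ^ i)"
    by (rule poly_sum_eventually_pos[where c="\<lambda>i. d i / real (i + 1)", OF sj]) (use dj in simp)
  ultimately have "\<forall>\<^sub>F x in at_top. 0 < g x \<and> 0 < f x + f (- x) \<and> 0 < H x \<and> 0 < x"
    using eventually_gt_at_top[of 0] by eventually_elim (simp add: Hx)
  then obtain X where X: "\<And>x. X \<le> x \<Longrightarrow> 0 < g x \<and> 0 < f x + f (- x) \<and> 0 < H x \<and> 0 < x"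
    unfolding eventually_at_top_linorder by blast
  have "continuous_on {0..X} g" unfolding g by (intro continuous_intros)
  then have "bounded (g ` {0..X})" by (intro compact_imp_bounded compact_continuous_image compact_Icc)
  then obtain K where K: "0 < K" "\<And>x. x \<in> {0..X} \<Longrightarrow> \<bar>g x\<bar> \<le> K"
    unfolding bounded_pos by auto
  define \<eta> where "\<eta> = (2 * K * X + 1) / H X"
  have "damping_comparison g f (\<lambda>x. - f (- x)) H X K \<eta>"
  proof
    show "0 < X" using X[of X] by simp
    show "0 \<le> g x \<and> - f (- x) \<le> f x" if "X \<le> x" for x using X[OF that] by simp
    show "(H has_real_derivative f x - - f (- x)) (at x)" for x using H .
    show "\<bar>g x\<bar> \<le> K" if "0 \<le> x" "x \<le> X" for x using K that by simp
    show "0 < \<eta>" using K X[of X] by (simp add: \<eta>_def add_pos_pos)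
    show "2 * K * X < \<eta> * (H X - H 0)" using X[of X] by (simp add: \<eta>_def H0)
  qed
  then show False using no_center_of_unequal_half_turns[OF rot odd] center by blast
qed

section \<open>Centers at infinity\<close>

theorem corollary1:
  fixes m n k s :: nat
    and a b :: "nat \<Rightarrow> real"
    and g f :: "real \<Rightarrow> real"
  assumes "k \<le> m" and "s \<le> n"
    and "\<And>x. g x = (\<Sum>i=k..m. a i * x ^ i)"
    and "\<And>x. f x = (\<Sum>i=s..n. b i * x ^ i)"
    and "a k * a m * b s * b n \<noteq> 0"
    and "odd_fun g"
  shows "center_at_infinity (lienard g f) \<longleftrightarrow>
    odd_fun f \<and> odd m \<and> odd n \<and>
    (m > 2 * n + 1 \<and> a m > 0 \<or>
     m = 2 * n + 1 \<and> 4 * (real n + 1) * a m / (b n)\<^sup>2 > 1)"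
proof -
  note km = assms(1) and sn = assms(2) and g = assms(3) and f = assms(4) and nz = assms(5) and odd_g = assms(6)
  have am: "a m \<noteq> 0" and ak: "a k \<noteq> 0" and bn: "b n \<noteq> 0" using nz by auto
  have k1: "1 \<le> k"
  proof (rule ccontr)
    assume "\<not> 1 \<le> k"
    then have "k = 0" by simp
    have "g 0 = (\<Sum>i=0..m. if i = 0 then a 0 else 0)"
      unfolding g \<open>k = 0\<close> by (rule sum.cong) (auto simp: power_0_left)
    then have "g 0 = a 0" by simp
    moreover have "g 0 = 0" using odd_g[unfolded odd_fun_def, rule_format, of 0] by simp
    ultimately show False using ak \<open>k = 0\<close> by simp
  qed
  have odd_m: "odd m" by (rule odd_degree_of_odd_fun[OF g km am odd_g])
  define N where "N = (m + 1) div 2"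
  have N: "m + 1 = 2 * N" using odd_m by (auto simp: N_def elim!: oddE)
  define growth where "growth \<longleftrightarrow> 2 * n + 1 < m \<and> 0 < a m \<or> m = 2 * n + 1 \<and> (b n)\<^sup>2 < 4 * (real n + 1) * a m"
  have growth: "growth \<longleftrightarrow> (m > 2 * n + 1 \<and> a m > 0 \<or> m = 2 * n + 1 \<and> 4 * (real n + 1) * a m / (b n)\<^sup>2 > 1)"
    using bn by (simp add: growth_def less_divide_eq)
  have growthD: "0 < a m" "n + 1 \<le> N" "n + 1 = N \<Longrightarrow> (b n)\<^sup>2 < 4 * real N * a m" if growth
  proof -
    show "0 < a m" using that zero_le_power2[of "b n"] unfolding growth_def
      by (smt (verit) mult_nonneg_nonpos of_nat_0_le_iff)
    show "n + 1 \<le> N" "n + 1 = N \<Longrightarrow> (b n)\<^sup>2 < 4 * real N * a m"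
      using that N by (auto simp: growth_def algebra_simps)
  qed
  have rotation: "\<exists>R c C. right_rotation (\<lambda>x. x + x ^ N) (\<lambda>x. 1 + real N * x ^ (N - 1)) g f R c C"
    if growth
    by (rule lienard_right_rotation[OF g f k1 km sn N]) (use growthD[OF that] in auto)
  show ?thesis
    unfolding growth[symmetric]
  proof
    assume center: "center_at_infinity (lienard g f)"
    have "0 < a m" using center_at_infinity_imp_restoring[OF center g km] am by simp
    then have gr: growth
      using center_at_infinity_imp_weak_damping[OF center g f km sn bn] by (auto simp: growth_def)
    define b' where "b' i = - (b i * (-1) ^ i)" for i
    define d where "d i = b i + b i * (-1) ^ i" for i
    have f': "- f (- x) = (\<Sum>i=s..n. b' i * x ^ i)" for x
      unfolding f poly_sum_minus_arg by (simp add: b'_def sum_negf)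
    have even: "f x + f (- x) = (\<Sum>i=s..n. d i * x ^ i)" for x
      unfolding f poly_sum_minus_arg by (simp add: d_def sum.distrib distrib_right)
    have b'n: "(b' n)\<^sup>2 = (b n)\<^sup>2" by (cases "even n") (simp_all add: b'_def)
    have "\<exists>R c C. right_rotation (\<lambda>x. x + x ^ N) (\<lambda>x. 1 + real N * x ^ (N - 1)) g (\<lambda>x. - f (- x)) R c C"
      by (rule lienard_right_rotation[OF g f' k1 km sn N]) (use growthD[OF gr] b'n in auto)
    then obtain R c C R' c' C' where
      rot: "right_rotation (\<lambda>x. x + x ^ N) (\<lambda>x. 1 + real N * x ^ (N - 1)) g f R c C" and
      rot': "right_rotation (\<lambda>x. x + x ^ N) (\<lambda>x. 1 + real N * x ^ (N - 1)) g (\<lambda>x. - f (- x)) R' c' C'"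
      using rotation[OF gr] by blast
    have odd_f: "odd_fun f"
    proof (rule ccontr)
      assume "\<not> odd_fun f"
      then obtain x where "f x + f (- x) \<noteq> 0" unfolding odd_fun_def by (metis add.commute add_eq_0_iff)
      then have ne: "{i \<in> {s..n}. d i \<noteq> 0} \<noteq> {}" unfolding even by (auto intro: sum.neutral)
      \<comment> \<open>The degree of the even part of \<open>f\<close>. If its leading coefficient is negative, the mirrored system has a positive one.\<close>
      define j where "j = Max {i \<in> {s..n}. d i \<noteq> 0}"
      have j: "j \<in> {s..n}" "d j \<noteq> 0" using Max_in[OF _ ne] by (auto simp: j_def)
      have top: "d i = 0" if "i \<in> {s..n} - {s..j}" for i
        using Max_ge[of "{i \<in> {s..n}. d i \<noteq> 0}" i] that j unfolding j_def[symmetric] by fastforce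
      have even_j: "f x + f (- x) = (\<Sum>i=s..j. d i * x ^ i)" for x
        unfolding even using j top by (intro sum.mono_neutral_right) auto
      have sj: "s \<le> j" using j by simp
      show False
      proof (cases "0 < d j")
        case True
        show False
          by (rule no_center_positive_even_part[OF center odd_g g km growthD(1)[OF gr] rot rot' even_j sj True])
      next
        case False
        have "- f (- x) + - f (- (- x)) = (\<Sum>i=s..j. - d i * x ^ i)" for x
          using even_j[of x] by (simp add: sum_negf)
        moreover have "right_rotation (\<lambda>x. x + x ^ N) (\<lambda>x. 1 + real N * x ^ (N - 1)) g (\<lambda>x. - (- f (- (- x)))) R c C"
          using rot by simp
        moreover have "0 < - d j" using False j by simp
        ultimately show False
          using no_center_positive_even_part[OF center_at_infinity_mirror[OF odd_g center] odd_g g km growthD(1)[OF gr] rot' _ _ sj,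
              of R c C "\<lambda>i. - d i"] by blast
      qed
    qed
    have "odd n" by (rule odd_degree_of_odd_fun[OF f sn bn odd_f])
    then show "odd_fun f \<and> odd m \<and> odd n \<and> growth" using odd_f odd_m gr by blast
  next
    assume "odd_fun f \<and> odd m \<and> odd n \<and> growth"
    then have odd_f: "odd_fun f" and gr: growth by auto
    obtain R c C where rot: "right_rotation (\<lambda>x. x + x ^ N) (\<lambda>x. 1 + real N * x ^ (N - 1)) g f R c C"
      using rotation[OF gr] by blast
    have fe: "g = (\<lambda>x. \<Sum>i=k..m. a i * x ^ i)" "f = (\<lambda>x. \<Sum>i=s..n. b i * x ^ i)" using g f by auto
    show "center_at_infinity (lienard g f)"
    proof (rule right_rotation.reversible_center_at_infinity[OF rot odd_g odd_f])
      fix B :: real assume B: "0 \<le> B"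
      obtain Lg Lf where "Lg-lipschitz_on {-B..B} g" "Lf-lipschitz_on {-B..B} f"
        unfolding fe using poly_sum_lipschitz_on_interval by blast
      then show "\<exists>L. L-lipschitz_on ({-B..B} \<times> {-B..B}) (lienard g f)"
        using lienard_lipschitz_on_box B by blast
    qed
  qed
qed

end
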